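(* Let $g,p,d\in\mathbb{N}$ with $d\ge 2$. The natural homomorphism $$\psi:\mathcal{AM}_{g,1,p}\to\mathcal{AM}_{g,1,p^{(d)}}$$ induced by the natural quotient homomorphism $\Sigma_{g,1,p}\to\Sigma_{g,1,p^{(d)}}$ is injective (for all $p\in\mathbb{N}$).
   Context: $\mathbb{N}=\{0,1,2,\ldots\}$. Write $\overline a=a^{-1}$, $[x,y]=\overline x\,\overline y\,x\,y$, and for a single element $a$ of a group let $[a]$ denote its conjugacy class. Automorphisms act on the right, with exponent notation $a^\phi$. An automorphism respects a set of elements (resp. of conjugacy classes) if it maps that set onto itself. An index-ordered product over an empty index set is $1$. $\Sigma_{g,1,p}$ is the free group of rank $2g+p$ with basis $x_1,\dots,x_g,y_1,\dots,y_g,t_1,\dots,t_p$. $\mathcal{AM}_{g,1,p}$ is the group of all automorphisms of $\Sigma_{g,1,p}$ which fix the element $[x_1,y_1]\cdots[x_g,y_g]\,t_1t_2\cdots t_p$ and permute the set of conjugacy classes $\{[\overline t_1],\dots,[\overline t_p]\}$. $\Sigma_{g,1,p^{(d)}}=\langle x_1,\dots,x_g,y_1,\dots,y_g,\tau_1,\dots,\tau_p\mid \tau_1^d,\dots,\tau_p^d\rangle$. $\mathcal{AM}_{g,1,p^{(d)}}$ is the group of all automorphisms of $\Sigma_{g,1,p^{(d)}}$ which fix $[x_1,y_1]\cdots[x_g,y_g]\,\tau_1\tau_2\cdots\tau_p$ and permute the set of conjugacy classes $\{[\overline\tau_1],\dots,[\overline\tau_p]\}$. The natural homomorphism $\Sigma_{g,1,p}\to\Sigma_{g,1,p^{(d)}}$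 is $x_i\mapsto x_i$, $y_i\mapsto y_i$, $t_k\mapsto\tau_k$. Its kernel is the normal closure of $t_1^d,\dots,t_p^d$, which is invariant under $\mathcal{AM}_{g,1,p}$; $\psi(\phi)$ is the automorphism induced by $\phi$ on the quotient. If $p=0$, $\psi$ is the identity. *)

theory Defs
  imports "HOL-Algebra.Bij" "HOL-Algebra.Generated_Groups"
begin

section \<open>Free groups\<close>

text \<open>
  The free group on a set \<open>S\<close> is realised on reduced words. A letter is a pair of a basis
  element and a sign; \<open>(a, True)\<close> is the basis element \<open>a\<close> itself, \<open>(a, False)\<close> its inverse.
\<close>

type_synonym 'a letter = "'a \<times> bool"

definition flip :: "'a letter \<Rightarrow> 'a letter" where
  "flip l = (fst l, \<not> snd l)"

definition reduced :: "'a letter list \<Rightarrow> bool" where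
  "reduced w \<longleftrightarrow> successively (\<lambda>l m. m \<noteq> flip l) w"

fun push :: "'a letter \<Rightarrow> 'a letter list \<Rightarrow> 'a letter list" where
  "push l [] = [l]"
| "push l (m # w) = (if m = flip l then w else l # m # w)"

definition free_group :: "'a set \<Rightarrow> 'a letter list monoid" where
  "free_group S =
    \<lparr>carrier = {w. reduced w \<and> fst ` set w \<subseteq> S}, mult = foldr push, one = []\<rparr>"

abbreviation gen :: "'a \<Rightarrow> 'a letter list" where
  "gen a \<equiv> [(a, True)]"

lemma flip_flip [simp]: "flip (flip l) = l"
  by (simp add: flip_def)

lemma fst_flip [simp]: "fst (flip l) = fst l"
  by (simp add: flip_def)

lemma reduced_Nil [simp]: "reduced []"
  by (simp add: reduced_def)

lemma reduced_Cons: "reduced (l # w) \<longleftrightarrow> (w = [] \<or> hd w \<noteq> flip l) \<and> reduced w"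
  by (cases w) (auto simp: reduced_def)

lemma reduced_push: "reduced w \<Longrightarrow> reduced (push l w)"
  by (cases w) (auto simp: reduced_Cons)

lemma set_push: "set (push l w) \<subseteq> insert l (set w)"
  by (cases w) auto

lemma push_flip_push: "reduced w \<Longrightarrow> push (flip l) (push l w) = w"
  by (cases w rule: remdups_adj.cases) (auto simp: reduced_Cons)

lemma push_push_flip: "reduced w \<Longrightarrow> push l (push (flip l) w) = w"
  using push_flip_push[of w "flip l"] by simp

lemma reduced_foldr_push: "reduced v \<Longrightarrow> reduced (foldr push u v)"
  by (induction u) (auto intro: reduced_push)

lemma set_foldr_push: "set (foldr push u v) \<subseteq> set u \<union> set v"
proof (induction u)
  case (Cons l u)
  then show ?case using set_push[of l "foldr push u v"] by auto
qed simp

lemma foldr_push_push: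
  assumes "reduced v" "reduced w"
  shows "foldr push (push l v) w = push l (foldr push v w)"
proof (cases v)
  case (Cons m v')
  show ?thesis
    using assms push_push_flip[OF reduced_foldr_push[OF assms(2)], of l v'] Cons by auto
qed simp

lemma foldr_push_assoc:
  assumes "reduced v" "reduced w"
  shows "foldr push (foldr push u v) w = foldr push u (foldr push v w)"
  using assms by (induction u) (simp_all add: foldr_push_push reduced_foldr_push)

lemma foldr_push_Nil: "reduced w \<Longrightarrow> foldr push w [] = w"
proof (induction w)
  case (Cons l w)
  then show ?case by (cases w) (auto simp: reduced_Cons)
qed simp

lemma foldr_push_inverse: "reduced v \<Longrightarrow> foldr push (rev (map flip w)) (foldr push w v) = v"
  by (induction w arbitrary: v) (simp_all add: push_flip_push reduced_foldr_push)

lemma free_group_group: "group (free_group S)"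
proof (rule groupI)
  fix u v assume "u \<in> carrier (free_group S)" "v \<in> carrier (free_group S)"
  then show "u \<otimes>\<^bsub>free_group S\<^esub> v \<in> carrier (free_group S)"
    using set_foldr_push[of u v] by (fastforce simp: free_group_def reduced_foldr_push)
next
  fix u assume u: "u \<in> carrier (free_group S)"
  define v where "v = foldr push (rev (map flip u)) []"
  have "reduced v" by (simp add: v_def reduced_foldr_push)
  moreover have "fst ` set v \<subseteq> S"
  proof -
    have "fst ` set v \<subseteq> fst ` set (map flip u)"
      using set_foldr_push[of "rev (map flip u)" "[]"] by (auto simp: v_def)
    also have "\<dots> = fst ` set u" by (simp add: image_image)
    also have "\<dots> \<subseteq> S" using u by (simp add: free_group_def)
    finally show ?thesis .
  qed
  moreover have "foldr push v u = []"
    using u foldr_push_assoc[of "[]" u "rev (map flip u)"] foldr_push_inverse[of "[]" u]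
    by (simp add: v_def free_group_def foldr_push_Nil)
  ultimately show "\<exists>v\<in>carrier (free_group S). v \<otimes>\<^bsub>free_group S\<^esub> u = \<one>\<^bsub>free_group S\<^esub>"
    by (auto simp: free_group_def)
qed (auto simp: free_group_def foldr_push_assoc)

lemma gen_closed [simp]: "gen a \<in> carrier (free_group S) \<longleftrightarrow> a \<in> S"
  by (simp add: free_group_def reduced_def)

section \<open>Constructions in an arbitrary group\<close>

definition normal_closure :: "('a, 'b) monoid_scheme \<Rightarrow> 'a set \<Rightarrow> 'a set" where
  "normal_closure G R =
    generate G {h \<otimes>\<^bsub>G\<^esub> r \<otimes>\<^bsub>G\<^esub> inv\<^bsub>G\<^esub> h | h r. h \<in> carrier G \<and> r \<in> R}"

definition comm :: "('a, 'b) monoid_scheme \<Rightarrow> 'a \<Rightarrow> 'a \<Rightarrow> 'a" where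
  "comm G a b = inv\<^bsub>G\<^esub> a \<otimes>\<^bsub>G\<^esub> inv\<^bsub>G\<^esub> b \<otimes>\<^bsub>G\<^esub> a \<otimes>\<^bsub>G\<^esub> b"

definition conj_class :: "('a, 'b) monoid_scheme \<Rightarrow> 'a \<Rightarrow> 'a set" where
  "conj_class G a = {inv\<^bsub>G\<^esub> h \<otimes>\<^bsub>G\<^esub> a \<otimes>\<^bsub>G\<^esub> h | h. h \<in> carrier G}"

definition ordered_prod :: "('a, 'b) monoid_scheme \<Rightarrow> 'a list \<Rightarrow> 'a" where
  "ordered_prod G as = foldr (mult G) as \<one>\<^bsub>G\<^esub>"

lemma (in group) normal_closure_normal:
  assumes "R \<subseteq> carrier G"
  shows "normal_closure G R \<lhd> G"
  unfolding normal_closure_def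
proof (rule normal_generateI)
  show "{h \<otimes> r \<otimes> inv h | h r. h \<in> carrier G \<and> r \<in> R} \<subseteq> carrier G"
    using assms by auto
next
  fix a g
  assume "a \<in> {h \<otimes> r \<otimes> inv h | h r. h \<in> carrier G \<and> r \<in> R}" and g: "g \<in> carrier G"
  then obtain h r where hr: "a = h \<otimes> r \<otimes> inv h" "h \<in> carrier G" "r \<in> R" by auto
  then have "g \<otimes> a \<otimes> inv g = (g \<otimes> h) \<otimes> r \<otimes> inv (g \<otimes> h)"
    using assms g by (auto simp: inv_mult_group m_assoc subset_iff)
  then show "g \<otimes> a \<otimes> inv g \<in> {h \<otimes> r \<otimes> inv h | h r. h \<in> carrier G \<and> r \<in> R}"
    using hr g by blast
qed

section \<open>The groups and their automorphism groups\<close>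

datatype surface_gen = X nat | Y nat | T nat

definition Sigma1 :: "nat \<Rightarrow> nat \<Rightarrow> surface_gen letter list monoid" where
  "Sigma1 g p = free_group (X ` {1..g} \<union> Y ` {1..g} \<union> T ` {1..p})"

definition power_relators :: "nat \<Rightarrow> nat \<Rightarrow> nat \<Rightarrow> surface_gen letter list set" where
  "power_relators g p d = {gen (T k) [^]\<^bsub>Sigma1 g p\<^esub> d | k. k \<in> {1..p}}"

definition Sigma1d_kernel :: "nat \<Rightarrow> nat \<Rightarrow> nat \<Rightarrow> surface_gen letter list set" where
  "Sigma1d_kernel g p d = normal_closure (Sigma1 g p) (power_relators g p d)"

definition Sigma1d :: "nat \<Rightarrow> nat \<Rightarrow> nat \<Rightarrow> surface_gen letter list set monoid" where
  "Sigma1d g p d = Sigma1 g p Mod Sigma1d_kernel g p d"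

definition natural_hom ::
    "nat \<Rightarrow> nat \<Rightarrow> nat \<Rightarrow> surface_gen letter list \<Rightarrow> surface_gen letter list set" where
  "natural_hom g p d w = Sigma1d_kernel g p d #>\<^bsub>Sigma1 g p\<^esub> w"

text \<open>
  The following group of automorphisms is defined for any group \<open>G\<close> with chosen elements
  \<open>x 1, \<dots>, x g, y 1, \<dots>, y g, t 1, \<dots>, t p\<close>. Automorphisms act on the right, so in the
  product of \<open>\<phi>\<close> and \<open>\<chi>\<close> the automorphism \<open>\<phi>\<close> is applied first; the library's
  \<^const>\<open>AutoGroup\<close> composes in the opposite order. The set of conjugacy classes is acted on
  by taking images, and permuting it means mapping it onto itself.
\<close>

definition AM_group ::
    "('a, 'b) monoid_scheme \<Rightarrow> nat \<Rightarrow> nat \<Rightarrow> (nat \<Rightarrow> 'a) \<Rightarrow> (nat \<Rightarrow> 'a) \<Rightarrow> (nat \<Rightarrow> 'a)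
      \<Rightarrow> ('a \<Rightarrow> 'a) monoid" where
  "AM_group G g p x y t =
    (let w = ordered_prod G (map (\<lambda>i. comm G (x i) (y i)) [1..<Suc g] @ map t [1..<Suc p]);
         C = {conj_class G (inv\<^bsub>G\<^esub> (t k)) | k. k \<in> {1..p}}
     in \<lparr>carrier = {\<phi> \<in> carrier (AutoGroup G). \<phi> w = w \<and> (\<lambda>c. \<phi> ` c) ` C = C},
         mult = (\<lambda>\<phi> \<chi>. \<chi> \<otimes>\<^bsub>AutoGroup G\<^esub> \<phi>),
         one = \<one>\<^bsub>AutoGroup G\<^esub>\<rparr>)"

definition AM1 ::
    "nat \<Rightarrow> nat \<Rightarrow> (surface_gen letter list \<Rightarrow> surface_gen letter list) monoid" where
  "AM1 g p =
    AM_group (Sigma1 g p) g p (\<lambda>i. gen (X i)) (\<lambda>i. gen (Y i)) (\<lambda>k. gen (T k))"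

definition AM1d ::
    "nat \<Rightarrow> nat \<Rightarrow> nat \<Rightarrow> (surface_gen letter list set \<Rightarrow> surface_gen letter list set) monoid" where
  "AM1d g p d =
    AM_group (Sigma1d g p d) g p (\<lambda>i. natural_hom g p d (gen (X i)))
      (\<lambda>i. natural_hom g p d (gen (Y i))) (\<lambda>k. natural_hom g p d (gen (T k)))"

text \<open>
  The induced automorphism sends a coset \<open>c\<close> to the common value of \<open>natural_hom (\<phi> a)\<close>
  for \<open>a \<in> c\<close>; see \<open>psi_natural_hom\<close> below. It is made extensional because the elements of
  \<^const>\<open>AutoGroup\<close> are.
\<close>

definition psi ::
    "nat \<Rightarrow> nat \<Rightarrow> nat \<Rightarrow> (surface_gen letter list \<Rightarrow> surface_gen letter list)
      \<Rightarrow> (surface_gen letter list set \<Rightarrow> surface_gen letter list set)" where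
  "psi g p d \<phi> =
    (\<lambda>c\<in>carrier (Sigma1d g p d). the_elem ((\<lambda>a. natural_hom g p d (\<phi> a)) ` c))"

lemma Sigma1_group: "group (Sigma1 g p)"
  by (simp add: Sigma1_def free_group_group)

lemma gen_T_closed: "k \<in> {1..p} \<Longrightarrow> gen (T k) \<in> carrier (Sigma1 g p)"
  by (auto simp: Sigma1_def)

lemma Sigma1d_kernel_normal: "Sigma1d_kernel g p d \<lhd> Sigma1 g p"
proof -
  interpret group "Sigma1 g p" by (rule Sigma1_group)
  show ?thesis
    unfolding Sigma1d_kernel_def
    by (rule normal_closure_normal) (auto simp: power_relators_def gen_T_closed)
qed

lemma Sigma1d_group: "group (Sigma1d g p d)"
  unfolding Sigma1d_def by (rule normal.factorgroup_is_group[OF Sigma1d_kernel_normal])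

lemma natural_hom_hom: "natural_hom g p d \<in> hom (Sigma1 g p) (Sigma1d g p d)"
  unfolding Sigma1d_def natural_hom_def
  using normal.r_coset_hom_Mod[OF Sigma1d_kernel_normal] .

lemma AM1_imp_hom: "\<phi> \<in> carrier (AM1 g p) \<Longrightarrow> \<phi> \<in> hom (Sigma1 g p) (Sigma1 g p)"
  by (simp add: AM1_def AM_group_def Let_def AutoGroup_def auto_def)

lemma AM1_kernel_invariant:
  assumes \<phi>: "\<phi> \<in> carrier (AM1 g p)" and n: "n \<in> Sigma1d_kernel g p d"
  shows "\<phi> n \<in> Sigma1d_kernel g p d"
proof -
  let ?G = "Sigma1 g p" and ?N = "Sigma1d_kernel g p d"
  let ?t = "\<lambda>k. gen (T k)"
  interpret N: normal ?N ?G by (rule Sigma1d_kernel_normal)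
  have perm: "(\<lambda>c. \<phi> ` c) ` {conj_class ?G (inv\<^bsub>?G\<^esub> ?t k) | k. k \<in> {1..p}}
      = {conj_class ?G (inv\<^bsub>?G\<^esub> ?t k) | k. k \<in> {1..p}}"
    using \<phi> by (simp add: AM1_def AM_group_def Let_def)
  interpret \<phi>: group_hom ?G ?G \<phi>
    using AM1_imp_hom[OF \<phi>] by (simp add: group_hom_def group_hom_axioms_def Sigma1_group)
  have relator: "?t k [^]\<^bsub>?G\<^esub> d \<in> ?N" if "k \<in> {1..p}" for k
  proof -
    have "\<one>\<^bsub>?G\<^esub> \<otimes>\<^bsub>?G\<^esub> (?t k [^]\<^bsub>?G\<^esub> d) \<otimes>\<^bsub>?G\<^esub> inv\<^bsub>?G\<^esub> \<one>\<^bsub>?G\<^esub> \<in> ?N"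
      unfolding Sigma1d_kernel_def normal_closure_def power_relators_def
      using that by (blast intro: generate.incl)
    then show ?thesis using that gen_T_closed by simp
  qed
  have image_relator: "\<phi> (?t k [^]\<^bsub>?G\<^esub> d) \<in> ?N" if k: "k \<in> {1..p}" for k
  proof -
    have tk: "?t k \<in> carrier ?G" using k by (rule gen_T_closed)
    have "inv\<^bsub>?G\<^esub> \<one>\<^bsub>?G\<^esub> \<otimes>\<^bsub>?G\<^esub> inv\<^bsub>?G\<^esub> ?t k \<otimes>\<^bsub>?G\<^esub> \<one>\<^bsub>?G\<^esub> \<in> conj_class ?G (inv\<^bsub>?G\<^esub> ?t k)"
      unfolding conj_class_def by blast
    then have "inv\<^bsub>?G\<^esub> ?t k \<in> conj_class ?G (inv\<^bsub>?G\<^esub> ?t k)" using tk by simp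
    moreover have "\<phi> ` conj_class ?G (inv\<^bsub>?G\<^esub> ?t k) \<in> {conj_class ?G (inv\<^bsub>?G\<^esub> ?t k) | k. k \<in> {1..p}}"
      using k perm by blast
    ultimately obtain j where j: "j \<in> {1..p}" "\<phi> (inv\<^bsub>?G\<^esub> ?t k) \<in> conj_class ?G (inv\<^bsub>?G\<^esub> ?t j)"
      by blast
    then obtain h where h: "h \<in> carrier ?G"
        "\<phi> (inv\<^bsub>?G\<^esub> ?t k) = inv\<^bsub>?G\<^esub> h \<otimes>\<^bsub>?G\<^esub> inv\<^bsub>?G\<^esub> ?t j \<otimes>\<^bsub>?G\<^esub> h"
      unfolding conj_class_def by blast
    have tj: "?t j \<in> carrier ?G" using j(1) by (rule gen_T_closed)
    have "inv\<^bsub>?G\<^esub> \<phi> (?t k) = inv\<^bsub>?G\<^esub> h \<otimes>\<^bsub>?G\<^esub> inv\<^bsub>?G\<^esub> ?t j \<otimes>\<^bsub>?G\<^esub> h"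
      using h(2) tk by simp
    then have "\<phi> (?t k) = inv\<^bsub>?G\<^esub> (inv\<^bsub>?G\<^esub> h \<otimes>\<^bsub>?G\<^esub> inv\<^bsub>?G\<^esub> ?t j \<otimes>\<^bsub>?G\<^esub> h)"
      using tk by (metis N.inv_inv \<phi>.hom_closed)
    also have "\<dots> = inv\<^bsub>?G\<^esub> h \<otimes>\<^bsub>?G\<^esub> ?t j \<otimes>\<^bsub>?G\<^esub> h"
      using h(1) tj by (simp add: N.inv_mult_group N.m_assoc)
    finally have eq: "\<phi> (?t k) = inv\<^bsub>?G\<^esub> h \<otimes>\<^bsub>?G\<^esub> ?t j \<otimes>\<^bsub>?G\<^esub> h" .
    have pow: "(inv\<^bsub>?G\<^esub> h \<otimes>\<^bsub>?G\<^esub> ?t j \<otimes>\<^bsub>?G\<^esub> h) [^]\<^bsub>?G\<^esub> m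
        = inv\<^bsub>?G\<^esub> h \<otimes>\<^bsub>?G\<^esub> (?t j [^]\<^bsub>?G\<^esub> m) \<otimes>\<^bsub>?G\<^esub> h" for m :: nat
    proof (induction m)
      case 0
      then show ?case using h(1) by simp
    next
      case (Suc m)
      have "h \<otimes>\<^bsub>?G\<^esub> (inv\<^bsub>?G\<^esub> h \<otimes>\<^bsub>?G\<^esub> z) = z" if "z \<in> carrier ?G" for z
        using that h(1) by (simp add: N.m_assoc[symmetric])
      then show ?case using Suc h(1) tj by (simp add: N.m_assoc)
    qed
    have "\<phi> (?t k [^]\<^bsub>?G\<^esub> d) = inv\<^bsub>?G\<^esub> h \<otimes>\<^bsub>?G\<^esub> (?t j [^]\<^bsub>?G\<^esub> d) \<otimes>\<^bsub>?G\<^esub> h"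
      using tk by (simp add: \<phi>.hom_nat_pow eq pow)
    also have "\<dots> \<in> ?N"
      using N.inv_op_closed1[OF h(1) relator[OF j(1)]] .
    finally show ?thesis .
  qed
  have conj: "\<phi> (h \<otimes>\<^bsub>?G\<^esub> r \<otimes>\<^bsub>?G\<^esub> inv\<^bsub>?G\<^esub> h) \<in> ?N"
      "h \<otimes>\<^bsub>?G\<^esub> r \<otimes>\<^bsub>?G\<^esub> inv\<^bsub>?G\<^esub> h \<in> carrier ?G"
    if h: "h \<in> carrier ?G" and "r \<in> power_relators g p d" for h r
  proof -
    have r: "r \<in> carrier ?G" "\<phi> r \<in> ?N"
      using that image_relator gen_T_closed by (auto simp: power_relators_def)
    show "h \<otimes>\<^bsub>?G\<^esub> r \<otimes>\<^bsub>?G\<^esub> inv\<^bsub>?G\<^esub> h \<in> carrier ?G"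
      using h r by simp
    show "\<phi> (h \<otimes>\<^bsub>?G\<^esub> r \<otimes>\<^bsub>?G\<^esub> inv\<^bsub>?G\<^esub> h) \<in> ?N"
      using h r N.inv_op_closed2[of "\<phi> h" "\<phi> r"] by simp
  qed
  have "n \<in> generate ?G {h \<otimes>\<^bsub>?G\<^esub> r \<otimes>\<^bsub>?G\<^esub> inv\<^bsub>?G\<^esub> h | h r.
      h \<in> carrier ?G \<and> r \<in> power_relators g p d}"
    using n by (simp add: Sigma1d_kernel_def normal_closure_def)
  then have "\<phi> n \<in> ?N \<and> n \<in> carrier ?G"
  proof (induction rule: generate.induct)
    case (incl n)
    then show ?case using conj by blast
  next
    case (inv n)
    then have "\<phi> n \<in> ?N" "n \<in> carrier ?G" using conj by blast+
    then show ?case by simp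
  qed simp_all
  then show ?thesis ..
qed

lemma psi_natural_hom:
  assumes \<phi>: "\<phi> \<in> carrier (AM1 g p)" and a: "a \<in> carrier (Sigma1 g p)"
  shows "psi g p d \<phi> (natural_hom g p d a) = natural_hom g p d (\<phi> a)"
proof -
  let ?G = "Sigma1 g p" and ?N = "Sigma1d_kernel g p d"
  interpret N: normal ?N ?G by (rule Sigma1d_kernel_normal)
  interpret \<phi>: group_hom ?G ?G \<phi>
    using AM1_imp_hom[OF \<phi>] by (simp add: group_hom_def group_hom_axioms_def Sigma1_group)
  have "natural_hom g p d (\<phi> b) = natural_hom g p d (\<phi> a)" if "b \<in> ?N #>\<^bsub>?G\<^esub> a" for b
  proof -
    from that obtain n where n: "n \<in> ?N" "b = n \<otimes>\<^bsub>?G\<^esub> a"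
      by (auto simp: r_coset_def)
    then have "\<phi> b = \<phi> n \<otimes>\<^bsub>?G\<^esub> \<phi> a" using a by simp
    then have "\<phi> b \<in> ?N #>\<^bsub>?G\<^esub> \<phi> a"
      using AM1_kernel_invariant[OF \<phi> n(1)] by (auto simp: r_coset_def)
    then show ?thesis
      using N.repr_independence[of "\<phi> b" ?N "\<phi> a"] a N.subgroup_axioms
      by (simp add: natural_hom_def)
  qed
  moreover have "a \<in> ?N #>\<^bsub>?G\<^esub> a"
    using N.rcos_self[OF a N.subgroup_axioms] .
  ultimately have "(\<lambda>b. natural_hom g p d (\<phi> b)) ` (?N #>\<^bsub>?G\<^esub> a) = {natural_hom g p d (\<phi> a)}"
    by blast
  then have "(\<lambda>b. natural_hom g p d (\<phi> b)) ` natural_hom g p d a = {natural_hom g p d (\<phi> a)}"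
    by (simp only: natural_hom_def[of g p d a])
  moreover have "natural_hom g p d a \<in> carrier (Sigma1d g p d)"
    using hom_in_carrier[OF natural_hom_hom a] .
  ultimately show ?thesis by (simp add: psi_def)
qed

end

(*
  Thicken the Cayley tree of the free group F to a planar surface whose boundary lines spell the
  surface word W and the inverses of the t_k. This puts a left-invariant cyclic order on F in which
  h W is the successor of h. The indicator f of the interval [1, v) is determined up to a constant
  by three properties: it changes at only finitely many edges of the tree, along W it jumps only
  on arrival at 1 and at v, and it has equal limits along the two ends of each coset of <t_k>.
  An automorphism phi in AM_{g,1,p} preserves all three, hence preserves the cyclic order. For a
  basis element u the chord from 1 to u crosses none of its translates, so neither does the chord
  from 1 to phi(u); but if phi(u) = a t_k^m b with |m| >= 2, then it crosses its translate by
  a t_k^{-1} a^{-1} (m > 0) or a t_k a^{-1} (m < 0). So phi(u) contains no t_k t_k and no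
  t_k^{-1} t_k^{-1}, and its image in the free product of the quotient is already in normal form.
  If psi(phi) = 1, this forces phi(u) = u, the alternative phi(t_k) = t_k^{-1} for d = 2 being
  excluded since phi(t_k) is conjugate to some t_j.
*)

theory Submission
  imports Defs
begin

section \<open>Cancellation in free groups\<close>

text \<open>An automorphism need not respect the edges of the Cayley tree, so planarity has to be
  expressed through data that it does respect: finite coboundary, translation by W, and the ends of
  the cosets of <t_k>. The last condition takes care of the corners through which no line spelling W
  passes. Indicators are taken as integer-valued functions because uniqueness up to a constant is
  then linear: the difference of two functions with the same jumps has none, hence is constant. The
  constant does no harm, since a crossing is detected by comparing the values at the two ends of a
  chord. Squares are what has to be excluded because d = 2 is allowed: t^m with |m| = 1 is
  nontrivial modulo every d >= 2, whereas t^2 may die. Powers of x_i and y_i may occur, but these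
  generators keep infinite order in the quotient.\<close>

lemma free_group_carrier: "u \<in> carrier (free_group S) \<longleftrightarrow> reduced u \<and> fst ` set u \<subseteq> S"
  by (simp add: free_group_def)

lemma free_group_mult: "u \<otimes>\<^bsub>free_group S\<^esub> v = foldr push u v"
  by (simp add: free_group_def)

lemma free_group_one: "\<one>\<^bsub>free_group S\<^esub> = []"
  by (simp add: free_group_def)

lemma flip_neq [simp]: "flip l \<noteq> l" "l \<noteq> flip l"
  by (auto simp: flip_def prod_eq_iff)

lemma flip_inject [simp]: "flip l = flip m \<longleftrightarrow> l = m"
  by (metis flip_flip)

lemma flip_Pair: "flip (a, b) = (a, \<not> b)"
  by (simp add: flip_def)

lemma flip_eq_iff: "flip l = m \<longleftrightarrow> l = flip m"
  by auto

lemma reduced_append: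
  "reduced (u @ v) \<longleftrightarrow> reduced u \<and> reduced v \<and> (u = [] \<or> v = [] \<or> hd v \<noteq> flip (last u))"
  by (auto simp: reduced_def successively_append_iff)

lemma foldr_push_append: "reduced (u @ v) \<Longrightarrow> foldr push u v = u @ v"
proof (induction u)
  case (Cons l u)
  then show ?case
    by (cases "u @ v") (auto simp: reduced_Cons)
qed simp

definition word_inv :: "'a letter list \<Rightarrow> 'a letter list" where
  "word_inv w = rev (map flip w)"

lemma word_inv_simps [simp]:
  "word_inv [] = []"
  "word_inv (u @ v) = word_inv v @ word_inv u"
  "word_inv (l # u) = word_inv u @ [flip l]"
  "word_inv (word_inv u) = u"
  "word_inv u = [] \<longleftrightarrow> u = []"
  "fst ` set (word_inv u) = fst ` set u"
  "length (word_inv u) = length u"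
  by (auto simp: word_inv_def rev_map[symmetric] image_image comp_def)

lemma hd_word_inv: "u \<noteq> [] \<Longrightarrow> hd (word_inv u) = flip (last u)"
  by (simp add: word_inv_def hd_rev last_map)

lemma last_word_inv: "u \<noteq> [] \<Longrightarrow> last (word_inv u) = flip (hd u)"
  by (simp add: word_inv_def last_rev hd_map)

lemma reduced_word_inv [simp]: "reduced (word_inv u) \<longleftrightarrow> reduced u"
proof -
  have "reduced u \<Longrightarrow> reduced (word_inv u)" for u :: "'a letter list"
    by (induction u) (auto simp: reduced_append reduced_Cons last_word_inv flip_eq_iff)
  from this[of u] this[of "word_inv u"] show ?thesis by auto
qed

lemma free_group_inv:
  assumes "u \<in> carrier (free_group S)"
  shows "inv\<^bsub>free_group S\<^esub> u = word_inv u"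
proof -
  interpret group "free_group S" by (rule free_group_group)
  show ?thesis
  proof (rule inv_equality[OF _ assms])
    show "word_inv u \<in> carrier (free_group S)"
      using assms by (simp add: free_group_carrier)
    show "word_inv u \<otimes>\<^bsub>free_group S\<^esub> u = \<one>\<^bsub>free_group S\<^esub>"
      using assms foldr_push_inverse[of "[]" u]
      by (simp add: free_group_mult free_group_one free_group_carrier word_inv_def foldr_push_Nil)
  qed
qed

text \<open>Naming the cancelled piece \<open>c\<close> lets later arguments read off the first
  letters of a product: they are those of \<open>u\<close> as long as \<open>a\<close> is long
  enough.\<close>

lemma cancellation:
  assumes "reduced u" "reduced v"
  obtains a c b where "u = a @ word_inv c" "v = c @ b" "reduced (a @ b)"
    "foldr push u v = a @ b"
proof -
  have "\<exists>a c b. u = a @ word_inv c \<and> v = c @ b \<and> reduced (a @ b) \<and> foldr push u v = a @ b"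
    using assms
  proof (induction u arbitrary: v rule: rev_induct)
    case Nil
    then show ?case by (intro exI[of _ "[]"] exI[of _ v]) simp
  next
    case (snoc l u)
    show ?case
    proof (cases "v = [] \<or> hd v \<noteq> flip l")
      case True
      then have "reduced ((u @ [l]) @ v)"
        using snoc.prems unfolding reduced_append[of "u @ [l]" v] by simp
      then show ?thesis
        using foldr_push_append[of "u @ [l]" v]
        by (intro exI[of _ "u @ [l]"] exI[of _ "[]"] exI[of _ v]) simp
    next
      case False
      then obtain v' where v: "v = flip l # v'" by (cases v) auto
      have "reduced u" "reduced v'"
        using snoc.prems v by (auto simp: reduced_append reduced_Cons)
      then obtain a c b where abc: "u = a @ word_inv c" "v' = c @ b" "reduced (a @ b)"
          "foldr push u v' = a @ b"
        using snoc.IH by blast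
      then have "foldr push (u @ [l]) v = a @ b"
        using v by simp
      then show ?thesis
        using abc v by (intro exI[of _ a] exI[of _ "flip l # c"] exI[of _ b]) simp
    qed
  qed
  then show ?thesis using that by blast
qed

lemma letter_pow:
  "[l] [^]\<^bsub>free_group S\<^esub> (n::nat) = replicate n l"
proof (induction n)
  case 0
  then show ?case by (simp add: free_group_one nat_pow_def)
next
  case (Suc n)
  have "reduced (replicate (Suc n) l)" for n :: nat
    by (induction n) (auto simp: reduced_Cons)
  then have "reduced (replicate n l @ [l])"
    by (metis replicate_Suc replicate_append_same)
  moreover have "[l] [^]\<^bsub>free_group S\<^esub> Suc n = replicate n l \<otimes>\<^bsub>free_group S\<^esub> [l]"
    using Suc by (simp add: nat_pow_def)
  ultimately show ?case
    using foldr_push_append[of "replicate n l" "[l]"]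
    by (simp add: free_group_mult replicate_append_same)
qed

lemma replicate_split:
  assumes "m \<ge> 2"
  obtains k where "replicate m x = x # x # replicate k x"
proof -
  obtain k where "m = Suc (Suc k)"
    using assms by (metis add_2_eq_Suc le_Suc_ex)
  then show ?thesis using that[of k] by simp
qed

lemma reduced_run:
  assumes "reduced a" "a = [] \<or> fst (last a) \<noteq> fst \<tau>"
  shows "reduced (a @ replicate n \<tau>)"
proof -
  have "reduced (replicate n \<tau>)"
    by (induction n) (auto simp: reduced_Cons)
  then show ?thesis
    using assms by (cases "n = 0") (auto simp: reduced_append)
qed

text \<open>\<open>a\<close> is the shortest element of the coset of \<open>h\<close> modulo the
  powers of \<open>t\<close>; the sign \<open>\<sigma>\<close> is arbitrary when
  \<open>i = 0\<close>.\<close>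

lemma trailing_run:
  "\<exists>a i \<sigma>. h = a @ replicate i (t, \<sigma>) \<and> (a = [] \<or> fst (last a) \<noteq> t)"
  if "reduced h"
  using that
proof (induction h rule: rev_induct)
  case (snoc l h)
  then obtain a i \<sigma> where h: "h = a @ replicate i (t, \<sigma>)" "a = [] \<or> fst (last a) \<noteq> t"
    by (auto simp: reduced_append)
  show ?case
  proof (cases "fst l = t")
    case False
    then show ?thesis by (intro exI[of _ "h @ [l]"] exI[of _ 0]) simp
  next
    case l: True
    show ?thesis
    proof (cases i)
      case 0
      then show ?thesis using h l
        by (intro exI[of _ a] exI[of _ 1] exI[of _ "snd l"]) auto
    next
      case (Suc j)
      then have "last h = (t, \<sigma>)" using h by simp
      moreover have "h \<noteq> []" using h Suc by simp
      ultimately have "l \<noteq> flip (t, \<sigma>)" using snoc.prems by (simp add: reduced_append)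
      then have "l = (t, \<sigma>)" using l by (auto simp: flip_def prod_eq_iff)
      then show ?thesis using h
        by (intro exI[of _ a] exI[of _ "Suc i"] exI[of _ \<sigma>]) (simp add: replicate_append_same)
    qed
  qed
qed simp

lemma not_successivelyE:
  assumes "\<not> successively R v"
  obtains \<alpha> x y \<beta> where "v = \<alpha> @ x # y # \<beta>" "\<not> R x y"
proof -
  have "\<exists>\<alpha> x y \<beta>. v = \<alpha> @ x # y # \<beta> \<and> \<not> R x y"
    using assms
  proof (induction v rule: induct_list012)
    case (3 x y v)
    show ?case
    proof (cases "R x y")
      case True
      then have "\<not> successively R (y # v)" using 3(3) by simp
      then obtain \<alpha> x' y' \<beta> where "y # v = \<alpha> @ x' # y' # \<beta>" "\<not> R x' y'"
        using 3(2) by blast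
      then show ?thesis by (intro exI[of _ "x # \<alpha>"]) auto
    next
      case False
      then show ?thesis by (intro exI[of _ "[]"]) auto
    qed
  qed simp_all
  then show ?thesis using that by blast
qed

section \<open>The planar structure of the Cayley tree\<close>

text \<open>
  \<open>pos\<close> orders the half-edges at a vertex, starting from the leg at which \<open>W\<close> begins and ends. The
  half-edge that follows \<open>flip l\<close> is the letter after \<open>l\<close> in the boundary word passing through that
  corner, which is \<open>W\<close>, or \<open>(t, False)\<close> repeated for a puncture \<open>t\<close>.
\<close>

locale ribbon =
  fixes S :: "'a set" and P :: "'a set" and pos :: "'a letter \<Rightarrow> nat" and W :: "'a letter list"
  assumes inj_pos: "inj_on pos {l. fst l \<in> S}"
    and W_letters: "fst ` set W \<subseteq> S"
    and W_complete: "\<And>l. fst l \<in> S \<Longrightarrow> snd l \<or> fst l \<notin> P \<Longrightarrow> l \<in> set W"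
    and W_succ: "successively (\<lambda>l m. pos m = Suc (pos (flip l))) W"
    and pos_hd: "\<And>l. W \<noteq> [] \<Longrightarrow> fst l \<in> S \<Longrightarrow> pos (hd W) \<le> pos l"
    and pos_last: "\<And>l. W \<noteq> [] \<Longrightarrow> fst l \<in> S \<Longrightarrow> pos l \<le> pos (flip (last W))"
    and P_sub: "P \<subseteq> S"
    and pos_P: "\<And>t. t \<in> P \<Longrightarrow> pos (t, False) = Suc (pos (t, True))"
begin

abbreviation "G \<equiv> free_group S"

abbreviation gmult (infixl "\<cdot>" 70) where "u \<cdot> v \<equiv> u \<otimes>\<^bsub>G\<^esub> v"

sublocale group G by (rule free_group_group)

lemma pos_eq: "fst l \<in> S \<Longrightarrow> fst m \<in> S \<Longrightarrow> pos l = pos m \<longleftrightarrow> l = m"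
  using inj_pos by (auto dest: inj_onD)

lemma W_adjacent: "W = \<alpha> @ x # y # \<beta> \<Longrightarrow> pos y = Suc (pos (flip x))"
  using W_succ by (auto simp: successively_append_iff)

text \<open>The letter after \<open>l\<close> sits one place beyond \<open>flip l\<close>, hence is
  not \<open>flip l\<close>.\<close>

lemma reduced_W: "reduced W"
  unfolding reduced_def using W_succ by (rule successively_mono) auto

lemma W_closed [simp]: "W \<in> carrier G"
  using reduced_W W_letters by (simp add: free_group_carrier)

lemma finite_S: "finite S"
proof -
  have "S \<subseteq> fst ` set W"
    using W_complete[of "(_, True)"] by force
  then show ?thesis by (rule finite_subset) simp
qed

text \<open>
  \<open>edge l\<close> is the indicator of the half-open interval from \<open>1\<close> to \<open>l\<close> in the cyclic order of the
  vertices, each vertex \<open>h\<close> being placed at its leg.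
\<close>

definition edge :: "'a letter \<Rightarrow> 'a letter list \<Rightarrow> int" where
  "edge l h = of_bool (h = [] \<or> pos (hd h) < pos l
     \<or> hd h = l \<and> tl h \<noteq> [] \<and> pos (flip l) < pos (hd (tl h)))"

lemma W_ne: "fst l \<in> S \<Longrightarrow> W \<noteq> []"
  using W_complete[of "(fst l, True)"] by auto

text \<open>\<open>h \<cdot> W\<close> is the next vertex after \<open>h\<close> in the cyclic
  order, so the indicator of the interval from \<open>1\<close> to \<open>l\<close> changes only on
  arrival at an endpoint. Since \<open>edge\<close> inspects at most two letters, the cases count
  the letters of \<open>h\<close> that survive the cancellation.\<close>

lemma edge_mult_W:
  assumes h: "h \<in> carrier G" and l: "fst l \<in> S"
  shows "edge l (h \<cdot> W) = edge l h + of_bool (h \<cdot> W = []) - of_bool (h \<cdot> W = [l])"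
proof -
  obtain a c b where abc: "h = a @ word_inv c" "W = c @ b" "reduced (a @ b)" "h \<cdot> W = a @ b"
    using cancellation[of h W] h reduced_W unfolding free_group_carrier free_group_mult by metis
  have "fst ` (set a \<union> set b \<union> set c) \<subseteq> S"
    using h W_letters by (simp add: abc free_group_carrier image_Un)
  then have S: "fst x \<in> S" if "x \<in> set a \<union> set b \<union> set c" for x
    using that by blast
  have red: "reduced (a @ word_inv c)" "reduced (c @ b)"
    using h reduced_W abc by (simp_all add: free_group_carrier)
  have first: "pos x \<le> pos q" if "W = x # \<beta>" "fst q \<in> S" for x \<beta> q
    using pos_hd[of q] that by simp
  have final: "pos q \<le> pos (flip x)" if "W = \<alpha> @ [x]" "fst q \<in> S" for x \<alpha> q
    using pos_last[of q] that by simp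
  note adj = W_adjacent
  note eq = pos_eq
  consider (two) q m a' where "a = q # m # a'" | (one) q where "a = [q]" | (zero) "a = []"
    by (cases a rule: remdups_adj.cases) auto
  then have "edge l (a @ b) = edge l (a @ word_inv c) + of_bool (a @ b = []) - of_bool (a @ b = [l])"
  proof cases
    case two
    then show ?thesis by (simp add: edge_def)
  next
    case one
    show ?thesis
    proof (cases "q = l")
      case False
      then show ?thesis using one abc by (simp add: edge_def)
    next
      case True
      then have q: "fst q \<in> S" "fst (flip q) \<in> S" using l by auto
      show ?thesis
      proof (cases c rule: rev_cases)
        case Nil
        then obtain y b' where b: "b = y # b'" using abc W_ne[OF l] by (cases b) auto
        then have "pos y \<le> pos (flip q)" using first abc Nil q by simp
        then show ?thesis using one True abc Nil b by (simp add: edge_def)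
      next
        case (snoc c' x)
        note c = snoc
        have x: "fst x \<in> S" "x \<noteq> q" using S c one red by (auto simp: reduced_Cons flip_eq_iff)
        show ?thesis
        proof (cases b)
          case Nil
          then have "pos (flip q) \<le> pos (flip x)" using final abc c q by simp
          moreover have "pos (flip q) \<noteq> pos (flip x)" using x q eq by (simp add: flip_eq_iff)
          ultimately show ?thesis using one True abc Nil c by (simp add: edge_def)
        next
          case (Cons y b')
          have y: "fst y \<in> S" "y \<noteq> flip q" using S Cons one red abc by (auto simp: reduced_Cons)
          \<comment> \<open>\<open>y\<close> comes immediately after \<open>flip x\<close>, so the
            third half-edge \<open>flip q\<close> cannot separate them.\<close>
          have "pos y = Suc (pos (flip x))" using adj[of c' x y b'] abc c Cons by simp
          moreover have "pos (flip q) \<noteq> pos y" using y q eq by simp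
          moreover have "pos (flip q) \<noteq> pos (flip x)" using x q eq by (simp add: flip_eq_iff)
          ultimately have "pos (flip q) < pos (flip x) \<longleftrightarrow> pos (flip q) < pos y"
            by auto
          then show ?thesis using one True abc Cons c by (simp add: edge_def)
        qed
      qed
    qed
  next
    case zero
    have l': "fst (flip l) \<in> S" using l by simp
    \<comment> \<open>The second clause of \<open>edge\<close> never holds here: if \<open>c\<close>
      ends in \<open>z\<close> followed by \<open>flip l\<close>, then \<open>flip l\<close> is the
      successor of \<open>flip z\<close>, so \<open>flip z\<close> does not lie beyond it.\<close>
    have inv_edge: "edge l (word_inv c) = of_bool (c = [] \<or> pos (flip (last c)) < pos l)"

    proof (cases c rule: rev_cases)
      case (snoc c' x)
      show ?thesis
      proof (cases "flip x = l \<and> c' \<noteq> []")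
        case True
        then obtain c'' z where "c' = c'' @ [z]" by (metis rev_exhaust)
        then have "pos (flip l) = Suc (pos (flip z))"
          using adj[of c'' z x b] abc snoc True by auto
        then show ?thesis using snoc True \<open>c' = _\<close> by (simp add: edge_def)
      next
        case False
        then show ?thesis using snoc by (auto simp: edge_def)
      qed
    qed (simp add: edge_def)
    \<comment> \<open>Here the second clause always holds: a letter after \<open>l\<close> in
      \<open>W\<close> is the successor of \<open>flip l\<close>.\<close>
    have out_edge: "edge l b = of_bool (b = [] \<or> pos (hd b) < pos l \<or> hd b = l) - of_bool (b = [l])"
    proof (cases b)
      case (Cons y b')
      show ?thesis
      proof (cases "y = l \<and> b' \<noteq> []")
        case True
        then obtain z b'' where "b' = z # b''" by (cases b') auto
        then have "pos z = Suc (pos (flip l))"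
          using adj[of c l z b''] abc Cons True by auto
        then show ?thesis using Cons True \<open>b' = _\<close> by (simp add: edge_def)
      next
        case False
        then show ?thesis using Cons by (auto simp: edge_def)
      qed
    qed (simp add: edge_def)
    consider (c) "c = []" | (b) "b = []" "c \<noteq> []" | (cb) c' x y b' where "c = c' @ [x]" "b = y # b'"
      by (metis neq_Nil_conv rev_exhaust)
    then show ?thesis
    proof cases
      case c
      then obtain y b' where b: "b = y # b'" using abc W_ne[OF l] by (cases b) auto
      then have "pos y \<le> pos l" using first abc c l by simp
      then have "pos y < pos l \<or> y = l"
        using eq[of y l] S[of y] b l by auto
      then show ?thesis using c b zero inv_edge out_edge by auto
    next
      case b
      then obtain c' x where c: "c = c' @ [x]" by (metis rev_exhaust)
      then have "pos l \<le> pos (flip x)" using final abc b l by simp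
      then show ?thesis using c b zero inv_edge out_edge by auto
    next
      case cb
      have y: "fst y \<in> S" using S cb by auto
      have "pos y = Suc (pos (flip x))" using adj[of c' x y b'] abc cb by simp
      then have "pos (flip x) < pos l \<longleftrightarrow> pos y < pos l \<or> y = l"
        using eq[OF y l] by auto
      then show ?thesis using cb zero inv_edge out_edge by auto
    qed
  qed
  then show ?thesis using abc(4) by (simp only: abc(1))
qed

text \<open>The corners at a vertex other than the two beside the leg: a boundary line arrives along
  \<open>flip q\<close> and leaves along \<open>r\<close>. In the second disjunct the line belongs
  to the puncture \<open>t\<close>.\<close>

definition adj :: "'a letter \<Rightarrow> 'a letter \<Rightarrow> bool" where
  "adj q r \<longleftrightarrow> (\<exists>\<alpha> \<beta>. W = \<alpha> @ flip q # r # \<beta>) \<or> (\<exists>t\<in>P. q = (t, True) \<and> r = (t, False))"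

lemma adj_pos: "adj q r \<Longrightarrow> pos r = Suc (pos q)"
  using W_adjacent[of _ "flip q"] pos_P unfolding adj_def by fastforce

lemma adj_letters: "adj q r \<Longrightarrow> fst q \<in> S \<and> fst r \<in> S"
  using W_letters P_sub by (auto simp: adj_def)

text \<open>Only the half-edge at which \<open>W\<close> begins has the leg, and no other half-edge,
  before it. \<open>succ_exists\<close> is the mirror image at the end of \<open>W\<close>.\<close>

lemma pred_exists:
  assumes "fst q \<in> S"
  obtains \<beta> where "W = q # \<beta>" | r where "adj r q"
proof (cases "q \<in> set W")
  case True
  then obtain \<alpha> \<beta> where W: "W = \<alpha> @ q # \<beta>" by (meson split_list)
  show ?thesis
  proof (cases \<alpha> rule: rev_cases)
    case Nil
    then show ?thesis using W that(1) by simp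
  next
    case (snoc \<alpha>' x)
    then have "W = \<alpha>' @ flip (flip x) # q # \<beta>" using W by simp
    then have "adj (flip x) q" unfolding adj_def by blast
    then show ?thesis using that(2) by blast
  qed
next
  case False
  then have "\<not> snd q" "fst q \<in> P" using W_complete[OF assms] by auto
  then have "adj (fst q, True) q" by (auto simp: adj_def prod_eq_iff)
  then show ?thesis using that(2) by blast
qed

lemma succ_exists:
  assumes "fst q \<in> S"
  obtains \<alpha> where "W = \<alpha> @ [flip q]" | r where "adj q r"
proof (cases "flip q \<in> set W")
  case True
  then obtain \<alpha> \<beta> where W: "W = \<alpha> @ flip q # \<beta>" by (meson split_list)
  show ?thesis
  proof (cases \<beta>)
    case Nil
    then show ?thesis using W that(1) by simp
  next
    case (Cons x \<beta>')
    then have "W = \<alpha> @ flip q # x # \<beta>'" using W by simp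
    then have "adj q x" unfolding adj_def by blast
    then show ?thesis using that(2) by blast
  qed
next
  case False
  then have "\<not> snd (flip q)" "fst q \<in> P" using W_complete[of "flip q"] assms by auto
  then have "adj q (fst q, False)" by (auto simp: adj_def prod_eq_iff flip_def)
  then show ?thesis using that(2) by blast
qed

section \<open>Functions with finite coboundary\<close>

text \<open>Finite coboundary, required for all group elements and not just for the generators, so
  that invariance under automorphisms is visible.\<close>

definition almost_inv :: "('a letter list \<Rightarrow> int) \<Rightarrow> bool" where
  "almost_inv f \<longleftrightarrow> (\<forall>g\<in>carrier G. finite {h \<in> carrier G. f (h \<cdot> g) \<noteq> f h})"

text \<open>If \<open>f\<close> has finite coboundary, its values along either end of a coset of the
  powers of \<open>t\<close> are eventually constant; the condition then says that the two limits
  agree.\<close>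

definition balanced :: "('a letter list \<Rightarrow> int) \<Rightarrow> bool" where
  "balanced f \<longleftrightarrow> (\<forall>h\<in>carrier G. \<forall>t\<in>P. \<exists>N. \<forall>n\<ge>N.
     f (h \<cdot> replicate n (t, True)) = f (h \<cdot> replicate n (t, False)))"

lemma mult_append: "reduced (u @ v) \<Longrightarrow> u \<cdot> v = u @ v"
  by (simp add: free_group_mult foldr_push_append)

lemma replicate_closed [simp]: "fst l \<in> S \<Longrightarrow> replicate n l \<in> carrier G"
  by (induction n) (auto simp: free_group_carrier reduced_Cons)

lemma almost_inv_combine:
  assumes "almost_inv f" "almost_inv f'"
  shows "almost_inv (\<lambda>h. F (f h) (f' h))"
  unfolding almost_inv_def
proof
  fix g assume "g \<in> carrier G"
  then have "finite ({h \<in> carrier G. f (h \<cdot> g) \<noteq> f h} \<union> {h \<in> carrier G. f' (h \<cdot> g) \<noteq> f' h})"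
    using assms by (simp add: almost_inv_def)
  then show "finite {h \<in> carrier G. F (f (h \<cdot> g)) (f' (h \<cdot> g)) \<noteq> F (f h) (f' h)}"
    by (rule rev_finite_subset) auto
qed

lemma balanced_combine:
  assumes "balanced f" "balanced f'"
  shows "balanced (\<lambda>h. F (f h) (f' h))"
  unfolding balanced_def
proof (intro ballI)
  fix h t assume "h \<in> carrier G" "t \<in> P"
  then obtain N N' where
    "\<forall>n\<ge>N. f (h \<cdot> replicate n (t, True)) = f (h \<cdot> replicate n (t, False))"
    "\<forall>n\<ge>N'. f' (h \<cdot> replicate n (t, True)) = f' (h \<cdot> replicate n (t, False))"
    using assms unfolding balanced_def by meson
  then show "\<exists>N. \<forall>n\<ge>N. F (f (h \<cdot> replicate n (t, True))) (f' (h \<cdot> replicate n (t, True))) =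
      F (f (h \<cdot> replicate n (t, False))) (f' (h \<cdot> replicate n (t, False)))"
    by (intro exI[of _ "max N N'"]) simp
qed

lemma almost_inv_translate:
  assumes "almost_inv f" "x \<in> carrier G"
  shows "almost_inv (\<lambda>h. f (x \<cdot> h))"
  unfolding almost_inv_def
proof
  fix g assume g: "g \<in> carrier G"
  let ?A = "{h \<in> carrier G. f (h \<cdot> g) \<noteq> f h}"
  have "h \<in> (\<lambda>h. inv\<^bsub>G\<^esub> x \<cdot> h) ` ?A" if "h \<in> carrier G" "f (x \<cdot> (h \<cdot> g)) \<noteq> f (x \<cdot> h)" for h
  proof
    show "h = inv\<^bsub>G\<^esub> x \<cdot> (x \<cdot> h)" using that assms by (simp add: m_assoc[symmetric])
    show "x \<cdot> h \<in> ?A" using that assms g by (simp add: m_assoc)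
  qed
  then have "{h \<in> carrier G. f (x \<cdot> (h \<cdot> g)) \<noteq> f (x \<cdot> h)} \<subseteq> (\<lambda>h. inv\<^bsub>G\<^esub> x \<cdot> h) ` ?A"
    by blast
  then show "finite {h \<in> carrier G. f (x \<cdot> (h \<cdot> g)) \<noteq> f (x \<cdot> h)}"
    using assms(1) g by (auto simp: almost_inv_def intro: finite_subset)
qed

lemma balanced_translate:
  assumes "balanced f" "x \<in> carrier G"
  shows "balanced (\<lambda>h. f (x \<cdot> h))"
  using assms P_sub unfolding balanced_def
  by (auto simp: m_assoc[symmetric] subset_iff)

text \<open>The first two letters of \<open>h\<close> determine \<open>edge l h\<close>, and right
  multiplication by \<open>g\<close> leaves them alone once \<open>h\<close> is longer than
  \<open>g\<close> by two letters.\<close>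

lemma almost_inv_edge: "almost_inv (edge l)"
  unfolding almost_inv_def
proof
  fix g assume g: "g \<in> carrier G"
  have "length h \<le> Suc (length g)" if h: "h \<in> carrier G" "edge l (h \<cdot> g) \<noteq> edge l h" for h
  proof (rule ccontr)
    assume long: "\<not> length h \<le> Suc (length g)"
    obtain a c b where abc: "h = a @ word_inv c" "g = c @ b" "h \<cdot> g = a @ b"
      using cancellation[of h g] h g unfolding free_group_carrier free_group_mult by metis
    then obtain q m a' where "a = q # m # a'"
      using long by (cases a rule: remdups_adj.cases) auto
    then have "edge l (a @ b) = edge l (a @ word_inv c)"
      by (simp add: edge_def)
    then show False using h(2) abc(3) unfolding abc(1) by simp
  qed
  then have "{h \<in> carrier G. edge l (h \<cdot> g) \<noteq> edge l h} \<subseteq>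
      {h. set h \<subseteq> S \<times> UNIV \<and> length h \<le> Suc (length g)}"
    by (force simp: free_group_carrier subset_iff image_iff)
  moreover have "finite \<dots>"
    using finite_S by (intro finite_lists_length_le) simp
  ultimately show "finite {h \<in> carrier G. edge l (h \<cdot> g) \<noteq> edge l h}"
    by (rule finite_subset)
qed

lemma pos_between:
  assumes "fst \<tau> \<in> P" "fst l \<in> S" "l \<noteq> \<tau>" "l \<noteq> flip \<tau>"
  shows "pos \<tau> < pos l \<longleftrightarrow> pos (flip \<tau>) < pos l" "pos l < pos \<tau> \<longleftrightarrow> pos l < pos (flip \<tau>)"
proof -
  have "pos (flip \<tau>) = Suc (pos \<tau>) \<or> pos \<tau> = Suc (pos (flip \<tau>))"
    using pos_P[OF assms(1)] by (cases \<tau>; cases "snd \<tau>") (auto simp: flip_def)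
  moreover have "pos l \<noteq> pos \<tau>" "pos l \<noteq> pos (flip \<tau>)"
    using assms P_sub pos_eq[of l \<tau>] pos_eq[of l "flip \<tau>"] by auto
  ultimately show "pos \<tau> < pos l \<longleftrightarrow> pos (flip \<tau>) < pos l" "pos l < pos \<tau> \<longleftrightarrow> pos l < pos (flip \<tau>)"
    by auto
qed

text \<open>\<open>\<tau>\<close> and \<open>flip \<tau>\<close> are neighbours at every vertex, so
  no other half-edge tells the two branches apart. Two copies are written because for
  \<open>l = \<tau>\<close> or \<open>l = flip \<tau>\<close> the second letter is inspected as
  well.\<close>

lemma edge_run:
  assumes \<tau>: "fst \<tau> \<in> P" and l: "fst l \<in> S"
    and a: "a = [] \<or> last a \<noteq> \<tau> \<and> last a \<noteq> flip \<tau>"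
  shows "edge l (a @ \<tau> # \<tau> # x) = edge l (a @ flip \<tau> # flip \<tau> # y)"
proof (cases a rule: remdups_adj.cases)
  case 1
  then show ?thesis
    using pos_between(1)[OF \<tau> l] by (cases "l = \<tau>"; cases "l = flip \<tau>") (auto simp: edge_def)
next
  case (2 q)
  then show ?thesis
    using pos_between(2)[OF \<tau>, of "flip l"] l a by (auto simp: edge_def flip_eq_iff)
qed (simp add: edge_def)

lemma balanced_edge:
  assumes l: "fst l \<in> S"
  shows "balanced (edge l)"
  unfolding balanced_def
proof (intro ballI)
  fix h t assume h: "h \<in> carrier G" and t: "t \<in> P"
  then obtain a i \<sigma> where a: "h = a @ replicate i (t, \<sigma>)" "a = [] \<or> fst (last a) \<noteq> t"
    using trailing_run[of h t] by (auto simp: free_group_carrier)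
  have red: "reduced a" using h a by (simp add: free_group_carrier reduced_append)
  have plus: "h \<cdot> replicate n (t, \<sigma>) = a @ replicate (i + n) (t, \<sigma>)" for n
    using reduced_run[OF red, of "(t, \<sigma>)" "i + n"] a mult_append[of h "replicate n (t, \<sigma>)"]
    by (simp add: replicate_add)
  have minus: "h \<cdot> replicate n (t, \<not> \<sigma>) = a @ replicate (n - i) (t, \<not> \<sigma>)" if "i \<le> n" for n
proof -
    have inv: "word_inv (replicate i (t, \<sigma>)) = replicate i (t, \<not> \<sigma>)"
      by (simp add: word_inv_def flip_def)
    have closed: "a \<in> carrier G" "replicate m (t, \<rho>) \<in> carrier G" for m \<rho>
      using h a t P_sub by (simp_all add: free_group_carrier[of a] red subset_iff) (auto simp: free_group_carrier)
    have mult: "replicate i (t, \<rho>) \<cdot> replicate m (t, \<rho>) = replicate (i + m) (t, \<rho>)" for m \<rho>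
      using reduced_run[of "[]" "(t, \<rho>)" "i + m"]
      by (simp add: mult_append replicate_add)
    have "h \<cdot> replicate n (t, \<not> \<sigma>) =
        (a \<cdot> replicate i (t, \<sigma>)) \<cdot> (replicate i (t, \<not> \<sigma>) \<cdot> replicate (n - i) (t, \<not> \<sigma>))"
      using h a that by (simp add: mult mult_append free_group_carrier)
    also have "\<dots> = a \<cdot> (replicate i (t, \<sigma>) \<cdot> inv\<^bsub>G\<^esub> replicate i (t, \<sigma>)) \<cdot> replicate (n - i) (t, \<not> \<sigma>)"
      using closed by (simp add: m_assoc free_group_inv inv del: r_inv l_inv)
    also have "\<dots> = a @ replicate (n - i) (t, \<not> \<sigma>)"
      using closed reduced_run[OF red, of "(t, \<not> \<sigma>)" "n - i"] a(2)
      by (simp add: mult_append)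
    finally show ?thesis .
  qed
  \<comment> \<open>From \<open>i + 2\<close> on, the trailing run of \<open>h\<close> is undone on
    one side and at least two letters remain on both, as \<open>edge_run\<close> requires.\<close>
  have "edge l (h \<cdot> replicate n (t, \<sigma>)) = edge l (h \<cdot> replicate n (t, \<not> \<sigma>))" if "n \<ge> i + 2" for n
  proof -
    have "2 \<le> i + n" "2 \<le> n - i" using that by simp_all
    then obtain x y where x: "replicate (i + n) (t, \<sigma>) = (t, \<sigma>) # (t, \<sigma>) # replicate x (t, \<sigma>)"
      and y: "replicate (n - i) (t, \<not> \<sigma>) = (t, \<not> \<sigma>) # (t, \<not> \<sigma>) # replicate y (t, \<not> \<sigma>)"
      by (metis replicate_split)
    have "flip (t, \<sigma>) = (t, \<not> \<sigma>)" by (simp add: flip_def)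
    moreover have "a = [] \<or> last a \<noteq> (t, \<sigma>) \<and> last a \<noteq> flip (t, \<sigma>)"
      using a(2) by auto
    ultimately show ?thesis
      using edge_run[of "(t, \<sigma>)" l a "replicate x (t, \<sigma>)" "replicate y (t, \<not> \<sigma>)"] t l
        plus[of n] minus[of n] that unfolding x y by simp
  qed
  then have "\<forall>n\<ge>i + 2. edge l (h \<cdot> replicate n (t, True)) = edge l (h \<cdot> replicate n (t, False))"
    by (cases \<sigma>) fastforce+
  then show "\<exists>N. \<forall>n\<ge>N. edge l (h \<cdot> replicate n (t, True)) = edge l (h \<cdot> replicate n (t, False))"
    by blast
qed

text \<open>
  Up to an additive constant, \<open>Phi v\<close> is the indicator of the interval from \<open>1\<close> to \<open>v\<close>: the intervals
  of the edges on the path from \<open>1\<close> to \<open>v\<close> concatenate.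
\<close>

primrec Phi :: "'a letter list \<Rightarrow> 'a letter list \<Rightarrow> int" where
  "Phi [] h = 0"
| "Phi (l # v) h = edge l h + Phi v (push (flip l) h)"

lemma push_mult: "push l h = [l] \<cdot> h"
  by (simp add: free_group_mult)

lemma letter_closed: "[l] \<in> carrier G \<longleftrightarrow> fst l \<in> S"
  by (simp add: free_group_carrier reduced_Cons)

lemma Phi_almost_inv: "v \<in> carrier G \<Longrightarrow> almost_inv (Phi v)"
proof (induction v)
  case Nil
  then show ?case by (simp add: almost_inv_def)
next
  case (Cons l v)
  then have "almost_inv (Phi v)" "fst l \<in> S" by (auto simp: free_group_carrier reduced_Cons)
  then have "almost_inv (\<lambda>h. edge l h + Phi v ([flip l] \<cdot> h))"
    by (intro almost_inv_combine[of _ _ "(+)"] almost_inv_edge almost_inv_translate)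
      (simp_all add: letter_closed)
  moreover have "Phi (l # v) = (\<lambda>h. edge l h + Phi v ([flip l] \<cdot> h))"
    by (rule ext) (simp only: Phi.simps push_mult)
  ultimately show ?case by simp
qed

lemma Phi_balanced: "v \<in> carrier G \<Longrightarrow> balanced (Phi v)"
proof (induction v)
  case Nil
  then show ?case by (simp add: balanced_def)
next
  case (Cons l v)
  then have "balanced (Phi v)" "fst l \<in> S" by (auto simp: free_group_carrier reduced_Cons)
  then have "balanced (\<lambda>h. edge l h + Phi v ([flip l] \<cdot> h))"
    by (intro balanced_combine[of _ _ "(+)"] balanced_edge balanced_translate)
      (simp_all add: letter_closed)
  moreover have "Phi (l # v) = (\<lambda>h. edge l h + Phi v ([flip l] \<cdot> h))"
    by (rule ext) (simp only: Phi.simps push_mult)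
  ultimately show ?case by simp
qed

text \<open>Telescoping: the jump at the end of the first edge cancels the jump at the start of the
  translated remaining path.\<close>

lemma Phi_mult_W:
  "v \<in> carrier G \<Longrightarrow> h \<in> carrier G \<Longrightarrow>
    Phi v (h \<cdot> W) = Phi v h + of_bool (h \<cdot> W = []) - of_bool (h \<cdot> W = v)"
proof (induction v arbitrary: h)
  case (Cons l v)
  then have v: "v \<in> carrier G" "fst l \<in> S" and lv: "push l v = l # v"
    by (auto simp: free_group_carrier reduced_Cons) (cases v; simp)
  have lc: "[l] \<in> carrier G" "[flip l] \<in> carrier G" using v by (simp_all add: letter_closed)
  have "push (flip l) (h \<cdot> W) = push (flip l) h \<cdot> W"
    using Cons.prems lc by (simp add: push_mult m_assoc)
  moreover have "push (flip l) h \<in> carrier G"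
    using Cons.prems lc by (simp add: push_mult)
  moreover have "push (flip l) (h \<cdot> W) = z \<longleftrightarrow> h \<cdot> W = push l z" if "reduced z" for z
  proof -
    have "reduced (h \<cdot> W)"
      using Cons.prems(2) m_closed[of h W] W_closed unfolding free_group_carrier by blast
    then show ?thesis
      using that push_flip_push[of z l] push_push_flip[of "h \<cdot> W" l] by metis
  qed
  ultimately show ?case
    using Cons.IH[OF v(1), of "push (flip l) h"] edge_mult_W[OF Cons.prems(2) v(2)] v(1) lv
      free_group_carrier[of v S] by simp
qed simp

section \<open>Uniqueness of a function with given jumps along \<open>W\<close>\<close>

lemma almost_inv_jumps_finite:
  assumes "almost_inv f"
  shows "finite {h \<in> carrier G. h \<noteq> [] \<and> f h \<noteq> f (butlast h)}"
proof -
  let ?J = "\<lambda>l. {h \<in> carrier G. f (h \<cdot> [l]) \<noteq> f h}"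
  have "{h \<in> carrier G. h \<noteq> [] \<and> f h \<noteq> f (butlast h)} \<subseteq>
      (\<Union>l\<in>S \<times> UNIV. (\<lambda>h. h @ [l]) ` ?J l)"
  proof
    fix h assume h: "h \<in> {h \<in> carrier G. h \<noteq> [] \<and> f h \<noteq> f (butlast h)}"
    then have split: "h = butlast h @ [last h]" by simp
    then have "butlast h \<in> carrier G" "fst (last h) \<in> S" "butlast h \<cdot> [last h] = h"
      using h mult_append[of "butlast h" "[last h]"]
      by (auto simp: free_group_carrier[of h] free_group_carrier[of "butlast h"] reduced_append
          dest: in_set_butlastD) (metis reduced_append split)
    then show "h \<in> (\<Union>l\<in>S \<times> UNIV. (\<lambda>h. h @ [l]) ` ?J l)"
      using h split by (intro UN_I[of "last h"] image_eqI[of _ _ "butlast h"]) (auto simp: mem_Times_iff)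
  qed
  moreover have "finite (?J l)" if "fst l \<in> S" for l
    using assms that unfolding almost_inv_def by (simp add: letter_closed)
  then have "finite (\<Union>l\<in>S \<times> UNIV. (\<lambda>h. h @ [l]) ` ?J l)"
    using finite_S by auto
  ultimately show ?thesis by (rule finite_subset)
qed

text \<open>
  At a jump farthest from \<open>1\<close>, all branches but one at the vertex carry constant values, and going
  round the vertex from corner to corner these values agree.
\<close>

theorem almost_inv_constant:
  assumes f: "almost_inv f" "balanced f"
    and fW: "\<And>h. h \<in> carrier G \<Longrightarrow> f (h \<cdot> W) = f h"
    and h: "h \<in> carrier G"
  shows "f h = f []"
proof -
  let ?J = "{h \<in> carrier G. h \<noteq> [] \<and> f h \<noteq> f (butlast h)}"
  have "?J = {}"
  proof (rule ccontr)
    assume "?J \<noteq> {}"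
    moreover have fin: "finite (length ` ?J)"
      using almost_inv_jumps_finite[OF f(1)] by simp
    ultimately have "Max (length ` ?J) \<in> length ` ?J" by (intro Max_in) simp_all
    then obtain j where j: "j \<in> ?J" "Max (length ` ?J) = length j" by (rule imageE)
    have max: "length i \<le> length j" if "i \<in> ?J" for i
      unfolding j(2)[symmetric] using fin that by (intro Max_ge imageI)
    define k l where "k = butlast j" "l = last j"
    then have jkl: "j = k @ [l]" using j by simp
    have kl: "k @ [l] \<in> carrier G" "f (k @ [l]) \<noteq> f k"
      using j unfolding jkl by auto
    then have k: "k \<in> carrier G" "reduced k" "fst l \<in> S"
      by (auto simp: free_group_carrier reduced_append)
    have branch: "f (k @ q # z) = f (k @ [q])" if "k @ q # z \<in> carrier G" for q z
      using that
    proof (induction z rule: rev_induct)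
      case (snoc x z)
      then have "k @ q # z \<in> carrier G"
        using reduced_append[of "k @ q # z" "[x]"] by (simp add: free_group_carrier)
      moreover have "\<not> length (k @ q # z @ [x]) \<le> length j"
        unfolding jkl by simp
      then have "k @ q # z @ [x] \<notin> ?J" using max by blast
      then have "f (k @ q # z @ [x]) = f (k @ q # z)"
        using snoc.prems by (simp add: butlast_append)
      ultimately show ?case using snoc.IH by simp
    qed simp
    have closed: "k @ x \<in> carrier G \<and> k \<cdot> x = k @ x"
      if "x \<in> carrier G" "x \<noteq> []" "k = [] \<or> hd x \<noteq> flip (last k)" for x
      using that k mult_append[of k x] by (auto simp: free_group_carrier reduced_append)
    have cancel: "(k @ word_inv c) \<cdot> (c @ b) = k \<cdot> b"
      if "c @ b \<in> carrier G" "k @ word_inv c \<in> carrier G" for c b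
    proof -
      have c: "c \<in> carrier G" "b \<in> carrier G"
        using that by (auto simp: free_group_carrier reduced_append)
      have "inv\<^bsub>G\<^esub> c \<cdot> (c \<cdot> b) = b"
        using c m_assoc[of "inv\<^bsub>G\<^esub> c" c b] by simp
      then have "(k \<cdot> word_inv c) \<cdot> (c \<cdot> b) = k \<cdot> b"
        using c k by (simp add: m_assoc free_group_inv[OF c(1), symmetric])
      then show ?thesis
        using that c k mult_append[of k "word_inv c"] mult_append[of c b]
        by (simp add: free_group_carrier[of "k @ _"] free_group_carrier[of "_ @ b"])
    qed
    \<comment> \<open>At a corner on a line spelling \<open>W\<close>, one translation by
      \<open>W\<close> leads from the branch of \<open>q\<close> into the branch of
      \<open>r\<close>. At a puncture corner the line is a coset of the powers of \<open>t\<close>,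
      whose two ends lie in these branches, and \<open>balanced\<close> compares them.\<close>
    have adj_eq: "f (k @ [q]) = f (k @ [r])"
      if "adj q r" "k = [] \<or> q \<noteq> flip (last k)" "k = [] \<or> r \<noteq> flip (last k)" for q r
      using that(1) unfolding adj_def
    proof (elim disjE exE bexE)
      fix \<alpha> \<beta> assume W: "W = \<alpha> @ flip q # r # \<beta>"
      let ?c = "\<alpha> @ [flip q]"
      have red: "?c @ r # \<beta> \<in> carrier G" using W W_closed by simp
      then have c: "word_inv ?c \<in> carrier G" "r # \<beta> \<in> carrier G"
        using reduced_append[of ?c "r # \<beta>"] reduced_word_inv[of ?c]
        by (auto simp: free_group_carrier)
      have q: "k @ word_inv ?c \<in> carrier G"
        using closed[OF c(1)] that by simp
      have r: "k @ r # \<beta> \<in> carrier G" "k \<cdot> (r # \<beta>) = k @ r # \<beta>"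
        using closed[OF c(2)] that by auto
      have "f (k @ word_inv ?c) = f (k @ r # \<beta>)"
        using fW[OF q] cancel[OF red q] r W by simp
      then show ?thesis using branch[of q "word_inv \<alpha>"] branch[OF r(1)] q by simp
    next
      fix t assume t: "t \<in> P" "q = (t, True) \<and> r = (t, False)"
      then obtain N where N: "f (k \<cdot> replicate (Suc N) q) = f (k \<cdot> replicate (Suc N) r)"
        using f(2) k(1) unfolding balanced_def by (metis lessI less_imp_le_nat)
      have "fst q \<in> S" "fst r \<in> S" using adj_letters[OF that(1)] by auto
      then have "replicate (Suc N) q \<in> carrier G" "replicate (Suc N) r \<in> carrier G"
        by (metis replicate_closed)+
      then have "k @ replicate (Suc N) x \<in> carrier G \<and> k \<cdot> replicate (Suc N) x = k @ replicate (Suc N) x"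
        if "x = q \<or> x = r" for x
        using closed[of "replicate (Suc N) x"] that \<open>k = [] \<or> q \<noteq> _\<close> \<open>k = [] \<or> r \<noteq> _\<close> by auto
      then show ?thesis
        using N branch[of q "replicate N q"] branch[of r "replicate N r"] by simp
    qed
    \<comment> \<open>The half-edge \<open>flip (last k)\<close> points back to \<open>1\<close>,
      where \<open>f\<close> is not known to be constant, so going round the vertex must not cross
      it. Half-edges before it are joined to the leg, and thus to \<open>f k\<close>, through the
      beginning of \<open>W\<close>; those after it, in \<open>down\<close>, through the end of
      \<open>W\<close>.\<close>
    have up: "f (k @ [q]) = f k" if "fst q \<in> S" "k = [] \<or> pos q < pos (flip (last k))" for q
      using that
    proof (induction "pos q" arbitrary: q rule: less_induct)
      case less
      then have q: "k = [] \<or> q \<noteq> flip (last k)" by auto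
      from less.prems(1) show ?case
      proof (cases rule: pred_exists)
        case (1 \<beta>)
        have "k @ q # \<beta> \<in> carrier G \<and> k \<cdot> W = k @ q # \<beta>"
          using closed[of W] 1 q W_closed by simp
        then show ?thesis using fW[OF k(1)] branch by auto
      next
        case (2 r)
        then have "pos r < pos q" "fst r \<in> S" using adj_pos adj_letters by auto
        moreover from this have r: "k = [] \<or> pos r < pos (flip (last k))" using less.prems by auto
        ultimately have "f (k @ [r]) = f k" using less.hyps by blast
        moreover have "k = [] \<or> r \<noteq> flip (last k)" using r by auto
        ultimately show ?thesis using adj_eq[OF 2] q by auto
      qed
    qed
    have down: "f (k @ [q]) = f k" if "fst q \<in> S" "k \<noteq> []" "pos (flip (last k)) < pos q" for q
      using that
    \<comment> \<open>The natural-number difference really decreases because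
      \<open>flip (last W)\<close> has the largest position.\<close>
    proof (induction "pos (flip (last W)) - pos q" arbitrary: q rule: less_induct)
      case less
      then have q: "k = [] \<or> q \<noteq> flip (last k)" by auto
      from less.prems(1) show ?case
      proof (cases rule: succ_exists)
        case (1 \<alpha>)
        have "word_inv W \<in> carrier G" using W_closed free_group_inv[of W S] inv_closed[of W] by simp
        then have c: "k @ word_inv W \<in> carrier G"
          using closed[of "word_inv W"] 1 q by simp
        have "f (k @ word_inv W) = f k"
          using fW[OF c] cancel[of W "[]"] c W_closed k r_one[of k] by (simp add: free_group_one)
        then show ?thesis using branch[of q "word_inv \<alpha>"] c 1 by simp
      next
        case (2 r)
        then have r: "pos r = Suc (pos q)" "fst r \<in> S" using adj_pos adj_letters by auto
        moreover have "pos r \<le> pos (flip (last W))" using pos_last[of r] W_ne[of r] r by simp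
        ultimately have "f (k @ [r]) = f k" using less.hyps[of r] less.prems by auto
        moreover have "r \<noteq> flip (last k)" using r less.prems by auto
        ultimately show ?thesis using adj_eq[OF 2] q by auto
      qed
    qed
    have "k = [] \<or> l \<noteq> flip (last k)"
      using kl(1) by (auto simp: free_group_carrier reduced_append)
    moreover have "k \<noteq> [] \<Longrightarrow> fst (flip (last k)) \<in> S"
      using k(1) last_in_set[of k] by (auto simp: free_group_carrier)
    ultimately have "k = [] \<or> pos l < pos (flip (last k)) \<or> pos (flip (last k)) < pos l"
      using pos_eq[of l "flip (last k)"] k(3) by fastforce
    then show False using up[OF k(3)] down[OF k(3)] kl(2) by blast
  qed
  with h show ?thesis
  proof (induction h rule: rev_induct)
    case (snoc x h)
    then have "h \<in> carrier G" by (auto simp: free_group_carrier reduced_append)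
    moreover have "f (h @ [x]) = f h"
      using snoc.prems by (auto simp: set_eq_iff)
    ultimately show ?case using snoc by simp
  qed simp
qed

section \<open>Self-crossings of words with squares\<close>

text \<open>The additive constant of \<open>Phi\<close>: the function \<open>Phi v\<close> takes
  only the values \<open>kappa v\<close> and \<open>kappa v + 1\<close> on reduced words. It counts
  the turns of the path \<open>v\<close> that run from a half-edge to one of larger
  position.\<close>

fun kappa :: "'a letter list \<Rightarrow> int" where
  "kappa [] = 0"
| "kappa [l] = 0"
| "kappa (l # m # v) = of_bool (pos (flip l) < pos m) + kappa (m # v)"

text \<open>Once \<open>s\<close> has left the path at its start, each later translate of
  \<open>s\<close> begins with the inverse of the letter just passed, so every further edge
  contributes the turn counted by \<open>kappa\<close>.\<close>

lemma Phi_branch: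
  assumes "reduced r" "reduced s" "r = [] \<or> s = [] \<or> hd s \<noteq> hd r"
  shows "Phi r s = kappa r + of_bool (r \<noteq> [] \<and> (s = [] \<or> pos (hd s) < pos (hd r)))"
  using assms
proof (induction r arbitrary: s rule: kappa.induct)
  case (2 l)
  then show ?case by (auto simp: edge_def)
next
  case (3 l m v)
  have push: "push (flip l) s = flip l # s"
    using 3(4) by (cases s) auto
  have red: "reduced (m # v)" "m \<noteq> flip l" "reduced (flip l # s)"
    using 3(2-4) by (auto simp: reduced_Cons)
  have "edge l s = of_bool (s = [] \<or> pos (hd s) < pos l)"
    using 3(4) by (auto simp: edge_def)
  then show ?case
    using 3(1)[OF red(1,3)] red(2) push by simp
qed simp

text \<open>The three indicators encode the cyclic orientation of \<open>flip l\<close>,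
  \<open>hd r\<close> and \<open>hd s\<close> at the vertex where the words part. An empty
  continuation stands for the leg, which precedes all half-edges.\<close>

lemma Phi_prefix:
  assumes "reduced (p @ l # r)" "reduced (p @ l # s)" "r = [] \<or> s = [] \<or> hd s \<noteq> hd r"
  shows "Phi (p @ l # r) (p @ l # s) + of_bool (r \<noteq> [] \<and> pos (flip l) < pos (hd r)) =
    kappa (p @ l # r) + of_bool (s \<noteq> [] \<and> pos (flip l) < pos (hd s))
    + of_bool (r \<noteq> [] \<and> (s = [] \<or> pos (hd s) < pos (hd r)))"
proof -
  have edge: "edge x (x # z) = of_bool (z \<noteq> [] \<and> pos (flip x) < pos (hd z))" for x z
    by (simp add: edge_def)
  show ?thesis
    using assms(1,2)
  proof (induction p)
    case Nil
    then have "reduced r" "reduced s" by (auto simp: reduced_Cons)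
    then have "Phi r s = kappa r + of_bool (r \<noteq> [] \<and> (s = [] \<or> pos (hd s) < pos (hd r)))"
      using Phi_branch assms(3) by blast
    moreover have "kappa (l # r) = of_bool (r \<noteq> [] \<and> pos (flip l) < pos (hd r)) + kappa r"
      by (cases r) auto
    ultimately show ?case by (simp add: edge)
  next
    \<comment> \<open>Both continuations show the same letter \<open>y\<close> after
      \<open>x\<close>, so the edge \<open>x\<close> contributes exactly its turn in
      \<open>kappa\<close>.\<close>
    case (Cons x p)
    obtain y z where "p @ [l] = y # z" by (cases "p @ [l]") auto
    then have "p @ l # w = y # z @ w" for w
      by (metis append_Cons append_assoc append_self_conv2)
    note pw = this
    show ?case using Cons by (simp add: edge reduced_Cons pw)
  qed
qed

text \<open>The chord from \<open>1\<close> to \<open>l\<close> crosses none of its translates; the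
  excluded ones share an endpoint with it. Multiplication by \<open>l\<close> affects only the end
  of \<open>h\<close>, which \<open>edge l\<close> inspects only in the excluded cases.\<close>

lemma edge_mult_gen:
  assumes "h \<in> carrier G" "h \<notin> {[], [l], [flip l]}"
  shows "edge l (h \<cdot> [l]) = edge l h"
proof (cases "last h = flip l")
  case True
  obtain k where h: "h = k @ [flip l]"
    using assms(2) True by (metis append_butlast_last_id insertCI)
  have "h \<cdot> [l] = k"
    using foldr_push_Nil[of k] assms(1) h
    by (simp add: free_group_mult free_group_carrier reduced_append)
  moreover have "edge l k = edge l (k @ [flip l])"
  proof (cases k rule: remdups_adj.cases)
    case (2 x)
    then have "x \<noteq> l" using assms(1) h by (auto simp: free_group_carrier reduced_Cons)
    then show ?thesis using 2 by (simp add: edge_def)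
  qed (use assms(2) h in \<open>auto simp: edge_def\<close>)
  ultimately show ?thesis using h by simp
next
  case False
  then have "h \<cdot> [l] = h @ [l]"
    using assms(1) by (intro mult_append) (auto simp: free_group_carrier reduced_append reduced_Cons flip_eq_iff)
  moreover have "edge l (h @ [l]) = edge l h"
    using assms(2) by (cases h rule: remdups_adj.cases) (auto simp: edge_def)
  ultimately show ?thesis by simp
qed

text \<open>
  The chord from \<open>1\<close> to \<open>v\<close> and its translate by \<open>h\<close> run together along a power of \<open>\<tau>\<close>; they lie on
  opposite sides at its two ends because \<open>\<tau>\<close> and \<open>flip \<tau>\<close> are neighbours in the cyclic order.
\<close>

lemma Phi_square:
  assumes v: "v = a @ \<tau> # replicate k \<tau> @ \<tau> # b" "v \<in> carrier G" "fst \<tau> \<in> P"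
    and a: "a = [] \<or> fst (last a) \<noteq> fst \<tau>" and b: "b = [] \<or> fst (hd b) \<noteq> fst \<tau>"
    and h: "h = a @ flip \<tau> # word_inv a"
  shows "h \<in> carrier G" "Phi v h \<noteq> Phi v (h \<cdot> v)"
proof -
  have letters: "fst ` set a \<subseteq> S" "fst \<tau> \<in> S" "fst ` set b \<subseteq> S"
    and red: "reduced a" "reduced v"
    using v by (auto simp: free_group_carrier reduced_append)
  have "hd (word_inv a) \<noteq> flip (flip \<tau>)" if "a \<noteq> []"
    using hd_word_inv[OF that] a that by (auto simp: flip_def)
  then have red_h: "reduced h"
    unfolding h using a red by (auto simp: reduced_append reduced_Cons)
  show hc: "h \<in> carrier G"
    using red_h letters by (simp add: free_group_carrier h image_Un)
  let ?x = "replicate k \<tau> @ \<tau> # b" and ?p = "a @ replicate k \<tau>"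
  have run: "replicate k \<tau> @ \<tau> # y = \<tau> # replicate k \<tau> @ y" for y
    by (simp add: replicate_app_Cons_same)
  \<comment> \<open>\<open>v\<close> and \<open>h \<cdot> v\<close> share \<open>a\<close> and
    \<open>k + 1\<close> letters \<open>\<tau>\<close>; then \<open>v\<close> continues with
    \<open>\<tau>\<close> and \<open>h \<cdot> v\<close> with \<open>b\<close>. The other endpoint
    \<open>h\<close> leaves \<open>v\<close> right after \<open>a\<close>, through
    \<open>flip \<tau>\<close> instead of \<open>\<tau>\<close>.\<close>
  have v': "v = ?p @ \<tau> # \<tau> # b" unfolding v(1) by (simp only: append_assoc run)
  have red_p: "reduced (?p @ \<tau> # b)"
  proof -
    have "reduced ?x" using red(2) by (simp add: v(1) reduced_append reduced_Cons)
    moreover have "hd ?x = \<tau>" by (cases k) auto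
    moreover have "\<tau> \<noteq> flip (last a)" if "a \<noteq> []" using a that by auto
    ultimately show ?thesis using red(1) reduced_append[of a ?x] by auto
  qed
  have hv: "h \<cdot> v = ?p @ \<tau> # b"
  proof -
    have ac: "a \<in> carrier G" "word_inv a \<in> carrier G" "[flip \<tau>] \<in> carrier G" "?x \<in> carrier G"
        "\<tau> # ?x \<in> carrier G"
      using v letters by (auto simp: free_group_carrier reduced_append reduced_Cons)
    have "h = a \<cdot> ([flip \<tau>] \<cdot> word_inv a)"
      using red_h mult_append[of a "flip \<tau> # word_inv a"] mult_append[of "[flip \<tau>]" "word_inv a"]
      by (simp add: h reduced_append reduced_Cons)
    moreover have "v = a \<cdot> (\<tau> # ?x)"
      using red(2) mult_append[of a "\<tau> # ?x"] by (simp add: v(1))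
    moreover have "word_inv a \<cdot> (a \<cdot> (\<tau> # ?x)) = \<tau> # ?x"
      using m_assoc[OF ac(2,1,5)] l_inv[OF ac(1)] l_one[OF ac(5)] by (simp add: free_group_inv[OF ac(1)])
    moreover have "[flip \<tau>] \<cdot> (\<tau> # ?x) = ?x"
      by (simp add: push_mult[symmetric])
    ultimately have "h \<cdot> v = a \<cdot> ?x"
      using ac by (simp add: m_assoc)
    then show ?thesis
      using mult_append[of a ?x] red_p by simp
  qed
  \<comment> \<open>Every other half-edge, and the leg, lies on the same side of
    \<open>\<tau>\<close> and \<open>flip \<tau>\<close>. The values at the two endpoints therefore
    become \<open>kappa v + e\<close> and \<open>kappa v + 1 - e\<close>, and
    \<open>2 * e = 1\<close> is impossible.\<close>
  define e :: int where "e = of_bool (pos (flip \<tau>) < pos \<tau>)"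
  have "b = [] \<or> hd b \<noteq> \<tau>" using b by auto
  then have "Phi v (h \<cdot> v) + e = kappa v + of_bool (b \<noteq> [] \<and> pos (flip \<tau>) < pos (hd b))
      + of_bool (b = [] \<or> pos (hd b) < pos \<tau>)"
    using Phi_prefix[of ?p \<tau> "\<tau> # b" b] red(2) red_p
    unfolding hv e_def unfolding v' by simp
  also have "\<dots> = kappa v + 1"
  proof (cases "b = []")
    case False
    then have "fst (hd b) \<in> S" "hd b \<noteq> \<tau>" "hd b \<noteq> flip \<tau>"
      using letters b by auto
    then show ?thesis
      using pos_between[OF v(3), of "hd b"] pos_eq[of "hd b" \<tau>] letters(2) by auto
  qed simp
  finally have 1: "Phi v (h \<cdot> v) + e = kappa v + 1" .
  have 2: "Phi v h = kappa v + e"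
  proof (cases a rule: rev_cases)
    case Nil
    then show ?thesis
      using Phi_branch[of v h] red red_h by (simp add: h v(1) e_def)
  next
    case (snoc p l)
    then have l: "fst (flip l) \<in> S" "flip l \<noteq> \<tau>" "flip l \<noteq> flip \<tau>"
      using letters a by auto
    have "Phi v h + of_bool (pos (flip l) < pos \<tau>) = kappa v + of_bool (pos (flip l) < pos (flip \<tau>)) + e"
      using Phi_prefix[of p l "\<tau> # ?x" "flip \<tau> # word_inv a"] red(2) red_h
      by (simp add: v(1) h snoc e_def)
    then show ?thesis using pos_between[OF v(3) l] by simp
  qed
  show "Phi v h \<noteq> Phi v (h \<cdot> v)"
    using 1 2 by (auto simp: e_def split: if_splits)
qed

lemma maximal_run:
  assumes "reduced v" "\<not> successively (\<lambda>l m. l = m \<longrightarrow> fst l \<notin> P) v"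
  obtains a \<tau> k b where "v = a @ \<tau> # replicate k \<tau> @ \<tau> # b" "fst \<tau> \<in> P"
    "a = [] \<or> fst (last a) \<noteq> fst \<tau>" "b = [] \<or> fst (hd b) \<noteq> fst \<tau>"
proof -
  obtain \<alpha> \<tau> \<beta> where v: "v = \<alpha> @ \<tau> # \<tau> # \<beta>" "fst \<tau> \<in> P"
    using assms(2) by (rule not_successivelyE) auto
  have red: "reduced (\<alpha> @ [\<tau>])" "reduced (\<tau> # \<beta>)"
    using assms(1) by (auto simp: v reduced_append reduced_Cons)
  obtain a i \<sigma> where a: "\<alpha> @ [\<tau>] = a @ replicate i (fst \<tau>, \<sigma>)" "a = [] \<or> fst (last a) \<noteq> fst \<tau>"
    using trailing_run[OF red(1), of "fst \<tau>"] by blast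
  obtain i' where i': "i = Suc i'"
  proof (cases i)
    case 0
    then have "a = \<alpha> @ [\<tau>]" using a(1) by simp
    then show ?thesis using a(2) by simp
  qed
  then have \<tau>: "(fst \<tau>, \<sigma>) = \<tau>" and \<alpha>: "\<alpha> = a @ replicate i' \<tau>"
    using a(1) by (auto simp flip: append_assoc replicate_append_same)
  define j b where "j = length (takeWhile ((=) \<tau>) \<beta>)" and "b = dropWhile ((=) \<tau>) \<beta>"
  have \<beta>: "\<beta> = replicate j \<tau> @ b"
    unfolding j_def b_def
    using replicate_length_same[of "takeWhile ((=) \<tau>) \<beta>" \<tau>] set_takeWhileD
    by (metis takeWhile_dropWhile_id)
  have "b = [] \<or> hd b \<noteq> \<tau>"
    unfolding b_def by (metis hd_dropWhile)
  moreover have "b = [] \<or> hd b \<noteq> flip \<tau>"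
  proof -
    have "\<tau> # \<beta> = replicate j \<tau> @ [\<tau>] @ b" by (simp add: \<beta> replicate_app_Cons_same)
    then have "reduced ([\<tau>] @ b)" using red(2) reduced_append by metis
    then show ?thesis by (auto simp: reduced_Cons)
  qed
  ultimately have b: "b = [] \<or> fst (hd b) \<noteq> fst \<tau>"
    by (auto simp: flip_def prod_eq_iff)
  have "v = a @ \<tau> # replicate (i' + j) \<tau> @ \<tau> # b"
    by (simp add: v(1) \<alpha> \<beta> replicate_add replicate_app_Cons_same)
  then show ?thesis using that v(2) a(2) b by blast
qed

end

section \<open>Automorphisms preserve the cyclic order\<close>

locale ribbon_auto = ribbon S P pos W for S :: "'a set" and P pos W +
  fixes \<phi> :: "'a letter list \<Rightarrow> 'a letter list"
  assumes \<phi>_hom: "\<phi> \<in> hom G G"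
    and \<phi>_bij: "bij_betw \<phi> (carrier G) (carrier G)"
    and \<phi>_W: "\<phi> W = W"
    and \<phi>_P: "\<And>t. t \<in> P \<Longrightarrow> \<exists>j\<in>P. \<exists>c\<in>carrier G. \<phi> (gen t) = inv\<^bsub>G\<^esub> c \<cdot> gen j \<cdot> c"
begin

sublocale \<phi>: group_hom G G \<phi>
  by unfold_locales (rule \<phi>_hom)

lemma \<phi>_inj: "x \<in> carrier G \<Longrightarrow> y \<in> carrier G \<Longrightarrow> \<phi> x = \<phi> y \<longleftrightarrow> x = y"
  using \<phi>_bij by (auto simp: bij_betw_def dest: inj_onD)

lemma almost_inv_comp:
  assumes "almost_inv f"
  shows "almost_inv (\<lambda>h. f (\<phi> h))"
  unfolding almost_inv_def
proof
  fix g assume g: "g \<in> carrier G"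
  let ?A = "{h \<in> carrier G. f (\<phi> (h \<cdot> g)) \<noteq> f (\<phi> h)}"
  have "\<phi> ` ?A \<subseteq> {h \<in> carrier G. f (h \<cdot> \<phi> g) \<noteq> f h}"
    using g by auto
  then have "finite (\<phi> ` ?A)"
    by (rule finite_subset) (use assms g in \<open>simp add: almost_inv_def\<close>)
  moreover have "inj_on \<phi> ?A"
    by (rule inj_onI) (simp add: \<phi>_inj)
  ultimately show "finite ?A" by (rule finite_imageD)
qed

text \<open>The elements \<open>x \<cdot> replicate n l\<close> are pairwise distinct, so only
  finitely many of them meet the finite exceptional set of \<open>c\<close>.\<close>

lemma almost_inv_replicate:
  assumes f: "almost_inv f" and x: "x \<in> carrier G" and c: "c \<in> carrier G" and l: "fst l \<in> S"
  shows "\<exists>N. \<forall>n\<ge>N. f (x \<cdot> replicate n l \<cdot> c) = f (x \<cdot> replicate n l)"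
proof -
  let ?A = "{n. f (x \<cdot> replicate n l \<cdot> c) \<noteq> f (x \<cdot> replicate n l)}"
  have cl: "replicate n l \<in> carrier G" for n using l by simp
  have "(\<lambda>n. x \<cdot> replicate n l) ` ?A \<subseteq> {h \<in> carrier G. f (h \<cdot> c) \<noteq> f h}"
    using x cl by auto
  then have "finite ((\<lambda>n. x \<cdot> replicate n l) ` ?A)"
    using f c by (auto simp: almost_inv_def intro: finite_subset)
  moreover have "inj (\<lambda>n. x \<cdot> replicate n l)"
    by (rule injI) (metis x cl Units_eq Units_l_cancel length_replicate)
  ultimately have "finite ?A"
    using finite_imageD inj_on_subset by blast
  then obtain N where "\<forall>n\<in>?A. n < N" using finite_nat_set_iff_bounded by blast
  then show ?thesis by (intro exI[of _ N]) (metis (mono_tags, lifting) mem_Collect_eq not_le)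
qed

lemma \<phi>_replicate:
  assumes "fst l \<in> S" "fst m \<in> S" "c \<in> carrier G" "\<phi> [l] = inv\<^bsub>G\<^esub> c \<cdot> [m] \<cdot> c"
  shows "\<phi> (replicate n l) = inv\<^bsub>G\<^esub> c \<cdot> replicate n m \<cdot> c"
proof (induction n)
  case 0
  then show ?case using assms \<phi>.hom_one by (simp add: free_group_one[of S, symmetric] del: \<phi>.hom_one)
next
  case (Suc n)
  have Suc_mult: "replicate (Suc n) x = [x] \<cdot> replicate n x" if "fst x \<in> S" for x
    using replicate_closed[OF that, of "Suc n"] mult_append[of "[x]" "replicate n x"]
    by (simp add: free_group_carrier)
  have cl: "[l] \<in> carrier G" "[m] \<in> carrier G" "replicate n l \<in> carrier G" "replicate n m \<in> carrier G"
    using assms by (simp_all add: letter_closed)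
  have cancel: "c \<cdot> (inv\<^bsub>G\<^esub> c \<cdot> z) = z" if "z \<in> carrier G" for z
    using that assms by (simp add: m_assoc[symmetric])
  show ?case
    unfolding Suc_mult[OF assms(1)] Suc_mult[OF assms(2)]
    using cl assms Suc cancel by (simp add: m_assoc)
qed

text \<open>The image of a coset of the powers of \<open>t\<close> is a coset of the powers of some
  \<open>j\<close>, multiplied by a conjugator \<open>c\<close> on the right. Finite coboundary
  makes \<open>c\<close> invisible in the limit, which is why \<open>almost_inv f\<close> is
  assumed.\<close>

lemma balanced_comp:
  assumes f: "almost_inv f" "balanced f"
  shows "balanced (\<lambda>h. f (\<phi> h))"
  unfolding balanced_def
proof (intro ballI)
  fix h t assume h: "h \<in> carrier G" and t: "t \<in> P"
  obtain j c where j: "j \<in> P" and c: "c \<in> carrier G" and eq: "\<phi> (gen t) = inv\<^bsub>G\<^esub> c \<cdot> gen j \<cdot> c"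
    using \<phi>_P[OF t] by blast
  have S: "t \<in> S" "j \<in> S" using t j P_sub by auto
  have inv_gen: "[(x, False)] = inv\<^bsub>G\<^esub> (gen x)" if "x \<in> S" for x
    using that by (simp add: free_group_inv letter_closed flip_def)
  have "\<phi> [(t, False)] = inv\<^bsub>G\<^esub> (\<phi> (gen t))"
    using S by (simp add: inv_gen letter_closed)
  also have "\<dots> = inv\<^bsub>G\<^esub> c \<cdot> [(j, False)] \<cdot> c"
    using S c by (simp add: eq inv_gen letter_closed inv_mult_group m_assoc)
  finally have eq': "\<phi> [(t, \<sigma>)] = inv\<^bsub>G\<^esub> c \<cdot> [(j, \<sigma>)] \<cdot> c" for \<sigma>
    using eq by (cases \<sigma>) auto
  let ?x = "\<phi> h \<cdot> inv\<^bsub>G\<^esub> c"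
  have x: "?x \<in> carrier G" using h c by simp
  have im: "\<phi> (h \<cdot> replicate n (t, \<sigma>)) = ?x \<cdot> replicate n (j, \<sigma>) \<cdot> c" for n \<sigma>
    using \<phi>_replicate[OF _ _ c eq', of \<sigma> n] S h c by (simp add: m_assoc)
  obtain N1 where N1: "\<forall>n\<ge>N1. f (?x \<cdot> replicate n (j, True) \<cdot> c) = f (?x \<cdot> replicate n (j, True))"
    using almost_inv_replicate[OF f(1) x c, of "(j, True)"] S by auto
  obtain N2 where N2: "\<forall>n\<ge>N2. f (?x \<cdot> replicate n (j, False) \<cdot> c) = f (?x \<cdot> replicate n (j, False))"
    using almost_inv_replicate[OF f(1) x c, of "(j, False)"] S by auto
  obtain N3 where N3: "\<forall>n\<ge>N3. f (?x \<cdot> replicate n (j, True)) = f (?x \<cdot> replicate n (j, False))"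
    using f(2) x j unfolding balanced_def by blast
  show "\<exists>N. \<forall>n\<ge>N. f (\<phi> (h \<cdot> replicate n (t, True))) = f (\<phi> (h \<cdot> replicate n (t, False)))"
    using N1 N2 N3 by (intro exI[of _ "max N1 (max N2 N3)"]) (simp add: im)
qed

text \<open>The jumps along \<open>W\<close> of the two sides match because \<open>\<phi>\<close> is
  injective and fixes \<open>W\<close>; the difference has no jump left and
  \<open>almost_inv_constant\<close> applies to it.\<close>

lemma Phi_equivariant:
  assumes v: "v \<in> carrier G"
  obtains k where "\<And>h. h \<in> carrier G \<Longrightarrow> Phi (\<phi> v) (\<phi> h) = Phi v h + k"
proof -
  let ?f = "\<lambda>h. Phi (\<phi> v) (\<phi> h) - Phi v h"
  have v': "\<phi> v \<in> carrier G" using v by simp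
  have ai: "almost_inv (\<lambda>h. Phi (\<phi> v) (\<phi> h))" "balanced (\<lambda>h. Phi (\<phi> v) (\<phi> h))"
    using almost_inv_comp balanced_comp Phi_almost_inv[OF v'] Phi_balanced[OF v'] by auto
  have f: "almost_inv ?f" "balanced ?f"
    using almost_inv_combine[OF ai(1) Phi_almost_inv[OF v], of "(-)"]
      balanced_combine[OF ai(2) Phi_balanced[OF v], of "(-)"] by auto
  have "?f (h \<cdot> W) = ?f h" if h: "h \<in> carrier G" for h
  proof -
    have hW: "h \<cdot> W \<in> carrier G" using h by simp
    have \<phi>hW: "\<phi> (h \<cdot> W) = \<phi> h \<cdot> W" using h \<phi>_W by simp
    have "\<phi> (h \<cdot> W) = [] \<longleftrightarrow> h \<cdot> W = []"
      using \<phi>_inj[OF hW one_closed] by (simp only: \<phi>.hom_one) (simp only: free_group_one)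
    moreover have "\<phi> (h \<cdot> W) = \<phi> v \<longleftrightarrow> h \<cdot> W = v"
      using \<phi>_inj[OF hW v] .
    ultimately show ?thesis
      using Phi_mult_W[OF v h] Phi_mult_W[OF v', of "\<phi> h"] h by (simp add: \<phi>hW)
  qed
  then have "?f h = ?f []" if "h \<in> carrier G" for h
    using almost_inv_constant[OF f _ that] by blast
  then show ?thesis using that[of "?f []"] by fastforce
qed

theorem \<phi>_gen_squarefree:
  assumes s: "s \<in> S"
  shows "successively (\<lambda>l m. l = m \<longrightarrow> fst l \<notin> P) (\<phi> (gen s))"
proof (rule ccontr)
  let ?u = "gen s" let ?v = "\<phi> ?u"
  assume nsf: "\<not> successively (\<lambda>l m. l = m \<longrightarrow> fst l \<notin> P) ?v"
  have u: "?u \<in> carrier G" using s by (simp add: letter_closed)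
  then have v: "?v \<in> carrier G" by simp
  then obtain a \<tau> k b where run: "?v = a @ \<tau> # replicate k \<tau> @ \<tau> # b" "fst \<tau> \<in> P"
      "a = [] \<or> fst (last a) \<noteq> fst \<tau>" "b = [] \<or> fst (hd b) \<noteq> fst \<tau>"
    using maximal_run[OF _ nsf] unfolding free_group_carrier by metis
  define h where "h = a @ flip \<tau> # word_inv a"
  note sq = Phi_square[OF run(1) v run(2-4) h_def]
  obtain h' where h': "h' \<in> carrier G" "\<phi> h' = h"
    using sq(1) \<phi>_bij unfolding bij_betw_def by (metis imageE)
  obtain c where c: "\<And>h. h \<in> carrier G \<Longrightarrow> Phi ?v (\<phi> h) = Phi ?u h + c"
    using Phi_equivariant[OF u] by blast
  have "Phi ?v h = edge (s, True) h' + c" "Phi ?v (h \<cdot> ?v) = edge (s, True) (h' \<cdot> ?u) + c"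
    using c[OF h'(1)] c[of "h' \<cdot> ?u"] h' u by simp_all
  then have "edge (s, True) (h' \<cdot> ?u) \<noteq> edge (s, True) h'"
    using sq(2) by auto
  \<comment> \<open>Pulled back by \<open>\<phi>\<close>, the crossing of \<open>Phi_square\<close>
    becomes a crossing of the chord of a generator, which leaves only the translates sharing an
    endpoint.\<close>
  then have "h' \<in> {[], ?u, [flip (s, True)]}"
    using edge_mult_gen[OF h'(1)] by blast
  moreover have "[flip (s, True)] = inv\<^bsub>G\<^esub> ?u"
    using u by (simp add: free_group_inv)
  ultimately have "h = [] \<or> h = ?v \<or> h = word_inv ?v"
    using h' u v \<phi>.hom_one free_group_inv[OF v] by (auto simp: free_group_one)
  moreover have "h \<noteq> []" "h \<noteq> ?v" unfolding run(1) by (simp_all add: h_def)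
  \<comment> \<open>Otherwise \<open>a\<close> would end in \<open>flip \<tau>\<close>, against the
    choice of a maximal run.\<close>
  moreover have "h \<noteq> word_inv ?v"
  proof
    assume "h = word_inv ?v"
    then have "word_inv h = ?v" by simp
    then have eq: "word_inv a = replicate k \<tau> @ \<tau> # b" unfolding run(1) by (simp add: h_def)
    then have "a \<noteq> []" by auto
    then have "flip (last a) = hd (word_inv a)" by (simp add: hd_word_inv)
    also have "\<dots> = \<tau>" unfolding eq by (cases k) auto
    finally show False using run(3) \<open>a \<noteq> []\<close> by auto
  qed
  ultimately show False by blast
qed

end

section \<open>Free products of cyclic groups\<close>

text \<open>
  The factor of the generator \<open>a\<close> has order \<open>m a\<close>, where \<open>m a = 0\<close> means infinite order: this
  works because \<open>x mod 0 = x\<close>.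
\<close>

definition letter_exp :: "('a \<Rightarrow> nat) \<Rightarrow> 'a letter \<Rightarrow> int" where
  "letter_exp m l = (if snd l then 1 else -1) mod int (m (fst l))"

text \<open>Van der Waerden's device: the letters act on normal forms of the free product by left
  multiplication, and the normal form of a word is what it makes of the empty list.\<close>

fun act :: "('a \<Rightarrow> nat) \<Rightarrow> 'a letter \<Rightarrow> ('a \<times> int) list \<Rightarrow> ('a \<times> int) list" where
  "act m l [] = [(fst l, letter_exp m l)]"
| "act m l ((b, e) # s) =
    (if fst l = b then
       let e' = (e + letter_exp m l) mod int (m b) in if e' = 0 then s else (b, e') # s
     else (fst l, letter_exp m l) # (b, e) # s)"

definition syllables :: "('a \<Rightarrow> nat) \<Rightarrow> ('a \<times> int) list \<Rightarrow> bool" where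
  "syllables m s \<longleftrightarrow> (\<forall>(a, e)\<in>set s. e \<noteq> 0 \<and> e mod int (m a) = e)
     \<and> successively (\<lambda>x y. fst x \<noteq> fst y) s"

text \<open>Only for order \<open>1\<close> do \<open>1\<close> and \<open>-1\<close> reduce to
  \<open>0\<close>; excluding it makes every letter a genuine syllable.\<close>

lemma letter_exp_nonzero: "m (fst l) \<noteq> 1 \<Longrightarrow> letter_exp m l \<noteq> 0"
  by (cases "m (fst l) = 0") (auto simp: letter_exp_def zmod_minus1)

lemma letter_exp_flip: "(letter_exp m l + letter_exp m (flip l)) mod int (m (fst l)) = 0"
  by (auto simp: letter_exp_def flip_def mod_simps)

lemma letter_exp_mod: "letter_exp m l mod int (m (fst l)) = letter_exp m l"
  by (simp add: letter_exp_def)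

lemma syllables_Nil [simp]: "syllables m []"
  by (simp add: syllables_def)

lemma syllables_Cons: "syllables m ((a, e) # s) \<longleftrightarrow>
    e \<noteq> 0 \<and> e mod int (m a) = e \<and> syllables m s \<and> (s = [] \<or> fst (hd s) \<noteq> a)"
  by (cases s) (auto simp: syllables_def)

context
  fixes m :: "'a \<Rightarrow> nat"
  assumes m: "\<And>a. m a \<noteq> 1"
begin

lemma syllables_act: "syllables m s \<Longrightarrow> syllables m (act m l s)"
  by (cases s) (auto simp: syllables_Cons letter_exp_nonzero[OF m] letter_exp_mod Let_def)

lemma act_flip_act:
  assumes "syllables m s"
  shows "act m (flip l) (act m l s) = s"
proof (cases s)
  case Nil
  then show ?thesis
    using letter_exp_flip[of m l] by simp
next
  case (Cons x s')
  obtain b e where x: "x = (b, e)" by (cases x)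
  show ?thesis
  proof (cases "fst l = b")
    case False
    then show ?thesis using Cons x letter_exp_flip[of m l] by simp
  next
    case b: True
    let ?M = "int (m b)"
    have e: "e \<noteq> 0" "e mod ?M = e" and s': "s' = [] \<or> fst (hd s') \<noteq> b"
      using assms Cons x by (auto simp: syllables_Cons)
    have sum: "(letter_exp m l + letter_exp m (flip l)) mod ?M = 0"
      using letter_exp_flip[of m l] b by simp
    have undo: "((e + letter_exp m l) mod ?M + letter_exp m (flip l)) mod ?M = e"
    proof -
      have "((e + letter_exp m l) mod ?M + letter_exp m (flip l)) mod ?M
          = (e + (letter_exp m l + letter_exp m (flip l)) mod ?M) mod ?M"
        by (simp add: mod_simps add.assoc)
      then show ?thesis using sum e by simp
    qed
    show ?thesis
    proof (cases "(e + letter_exp m l) mod ?M = 0")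
      case True
      then have "letter_exp m (flip l) = e"
        using undo letter_exp_mod[of m "flip l"] b by simp
      then show ?thesis using Cons x b True s' by (cases s') auto
    next
      case False
      then show ?thesis using Cons x b undo e by (simp add: Let_def)
    qed
  qed
qed

lemma syllables_foldr: "syllables m s \<Longrightarrow> syllables m (foldr (act m) w s)"
  by (induction w) (auto intro: syllables_act)

lemma foldr_act_push:
  "syllables m s \<Longrightarrow> foldr (act m) (push l v) s = act m l (foldr (act m) v s)"
  using act_flip_act[OF syllables_foldr, of s "flip l"] by (cases v) auto

lemma foldr_act_mult:
  "syllables m s \<Longrightarrow> foldr (act m) (foldr push u v) s = foldr (act m) u (foldr (act m) v s)"
  by (induction u) (simp_all add: foldr_act_push)

lemma foldr_act_replicate:
  assumes s: "syllables m s" and k: "k \<noteq> 0" "k = m a"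
  shows "foldr (act m) (replicate k (a, True)) s = s"
proof -
  have k1: "k \<noteq> 1" using m k by metis
  then have ex: "letter_exp m (a, True) = 1"
    using k by (simp add: letter_exp_def)
  \<comment> \<open>Generalised to any number of copies and any initial exponent, where
    \<open>e = 0\<close> stands for the absence of a leading syllable over \<open>a\<close>.\<close>
  have step: "foldr (act m) (replicate n (a, True)) s =
      (let e' = (e + int n) mod int k in if e' = 0 then r else (a, e') # r)"
    if "r = [] \<or> fst (hd r) \<noteq> a" "0 \<le> e" "e < int k" "s = (if e = 0 then r else (a, e) # r)" for n e r
  proof (induction n)
    case 0
    then show ?case using that by simp
  next
    case (Suc n)
    let ?e = "(e + int n) mod int k"
    have mod: "(?e + 1) mod int k = (e + int (Suc n)) mod int k"
      by (simp add: mod_simps ac_simps)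
    show ?case
    proof (cases "?e = 0")
      case True
      then have "(e + int (Suc n)) mod int k = 1" using mod k1 k by simp
      then show ?thesis using Suc True that(1) ex by (cases r) (auto simp: Let_def)
    next
      case False
      then show ?thesis using Suc mod ex k by (simp add: Let_def)
    qed
  qed
  show ?thesis
  proof (cases "\<exists>e r. s = (a, e) # r")
    case True
    then obtain e r where sr: "s = (a, e) # r" by blast
    then have e: "e \<noteq> 0" "e mod int k = e" "r = [] \<or> fst (hd r) \<noteq> a"
      using s k by (auto simp: syllables_Cons)
    then have "0 \<le> e" "e < int k" using k pos_mod_bound[of "int k" e] pos_mod_sign[of "int k" e] by simp_all
    then show ?thesis using step[of r e k] e sr by simp
  next
    case False
    then have "s = [] \<or> fst (hd s) \<noteq> a" by (cases s) auto
    then show ?thesis using step[of s 0 k] k by simp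
  qed
qed

text \<open>The relators fix all normal forms, and the elements that do so are closed under
  conjugation, products and inverses.\<close>

lemma foldr_act_normal_closure:
  assumes R: "\<And>r. r \<in> R \<Longrightarrow> r \<in> carrier (free_group S) \<and> (\<exists>a. r = replicate (m a) (a, True) \<and> m a \<noteq> 0)"
    and n: "n \<in> normal_closure (free_group S) R" and s: "syllables m s"
  shows "foldr (act m) n s = s"
proof -
  interpret group "free_group S" by (rule free_group_group)
  let ?K = "\<lambda>w. w \<in> carrier (free_group S) \<and> (\<forall>s. syllables m s \<longrightarrow> foldr (act m) w s = s)"
  have mult: "foldr (act m) (u \<otimes>\<^bsub>free_group S\<^esub> v) s = foldr (act m) u (foldr (act m) v s)"
    if "syllables m s" for u v s
    using foldr_act_mult[OF that] by (simp add: free_group_def)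
  have one: "foldr (act m) \<one>\<^bsub>free_group S\<^esub> s = s" for s
    by (simp add: free_group_def)
  have inv: "foldr (act m) u (foldr (act m) (inv\<^bsub>free_group S\<^esub> u) s) = s"
    if "syllables m s" "u \<in> carrier (free_group S)" for u s
    using mult[OF that(1), of u "inv\<^bsub>free_group S\<^esub> u"] that one by simp
  have K_inv: "?K (inv\<^bsub>free_group S\<^esub> u)" if "?K u" for u
    using that inv[of _ u] syllables_foldr by auto
  have conj: "?K (h \<otimes>\<^bsub>free_group S\<^esub> r \<otimes>\<^bsub>free_group S\<^esub> inv\<^bsub>free_group S\<^esub> h)"
    if h: "h \<in> carrier (free_group S)" and r: "r \<in> R" for h r
  proof -
    have "foldr (act m) r s = s" if "syllables m s" for s
      using R[OF r] foldr_act_replicate[OF that] by metis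
    then show ?thesis
      using h R[OF r] inv[OF _ h] by (auto simp: mult syllables_foldr)
  qed
  have "?K n"
    using n unfolding normal_closure_def
  proof (induction rule: generate.induct)
    case one
    then show ?case by (simp add: free_group_def)
  next
    case (incl h)
    then show ?case using conj by blast
  next
    case (inv h)
    then show ?case using conj K_inv by blast
  next
    case (eng h1 h2)
    then show ?case by (simp add: mult syllables_foldr)
  qed
  then show ?thesis using s by blast
qed

text \<open>Neighbours over the same torsion generator would be inverse or equal; both are excluded,
  so each torsion letter is a syllable by itself. In a factor of infinite order equal letters pile
  up with one sign, so \<open>\<bar>e\<bar> = 1\<close> means that nothing was merged.\<close>

lemma foldr_act_squarefree:
  assumes "reduced (l # v)" "successively (\<lambda>l k. l = k \<longrightarrow> m (fst l) = 0) (l # v)"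
  shows "\<exists>e s. foldr (act m) (l # v) [] = (fst l, e) # s \<and>
    (if m (fst l) = 0 then (if snd l then e \<ge> 1 else e \<le> -1) \<and> (\<bar>e\<bar> = 1 \<longrightarrow> s = foldr (act m) v [])
     else e = letter_exp m l \<and> s = foldr (act m) v [])"
  using assms
proof (induction v arbitrary: l)
  case Nil
  then show ?case by (auto simp: letter_exp_def)
next
  case (Cons k v)
  then have "reduced (k # v)" "successively (\<lambda>l k. l = k \<longrightarrow> m (fst l) = 0) (k # v)"
    by (auto simp: reduced_Cons)
  then obtain e s where es: "foldr (act m) (k # v) [] = (fst k, e) # s"
    "if m (fst k) = 0 then (if snd k then e \<ge> 1 else e \<le> -1) \<and> (\<bar>e\<bar> = 1 \<longrightarrow> s = foldr (act m) v [])
     else e = letter_exp m k \<and> s = foldr (act m) v []"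
    using Cons.IH by blast
  show ?case
  proof (cases "fst l = fst k")
    case False
    then show ?thesis using es(1) by (auto simp: letter_exp_def)
  next
    case True
    then have "l = k" using Cons.prems(1) by (auto simp: reduced_Cons flip_def prod_eq_iff)
    then have "m (fst k) = 0" using Cons.prems(2) by simp
    then show ?thesis using es \<open>l = k\<close> by (auto simp: letter_exp_def Let_def split: if_splits)
  qed
qed

text \<open>No later letter can be absorbed, so \<open>v\<close> has length one. The inverse letter
  remains because \<open>1\<close> and \<open>-1\<close> agree modulo \<open>2\<close>.\<close>

lemma squarefree_eq_gen:
  assumes red: "reduced v" and sf: "successively (\<lambda>l k. l = k \<longrightarrow> m (fst l) = 0) v"
    and eq: "foldr (act m) v [] = foldr (act m) (gen a) []"
  shows "v = gen a \<or> m a \<noteq> 0 \<and> v = [(a, False)]"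
proof (cases v)
  case Nil
  then show ?thesis using eq by simp
next
  case (Cons l w)
  have nonempty: "foldr (act m) w [] \<noteq> []" if "w \<noteq> []"
  proof -
    from that obtain k w' where "w = k # w'" by (cases w) auto
    then show ?thesis
      using foldr_act_squarefree[of k w'] red sf Cons by (auto simp: reduced_Cons)
  qed
  obtain e s where es: "foldr (act m) (l # w) [] = (fst l, e) # s"
    "if m (fst l) = 0 then (if snd l then e \<ge> 1 else e \<le> -1) \<and> (\<bar>e\<bar> = 1 \<longrightarrow> s = foldr (act m) w [])
     else e = letter_exp m l \<and> s = foldr (act m) w []"
    using foldr_act_squarefree[of l w] red sf Cons by blast
  then have l: "fst l = a" "e = letter_exp m (a, True)" "s = []"
    using eq Cons by auto
  show ?thesis
  proof (cases "m a = 0")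
    case True
    then have "snd l" "foldr (act m) w [] = []" using es(2) l by (auto simp: letter_exp_def split: if_splits)
    then show ?thesis using nonempty Cons l by (cases l) auto
  next
    case False
    then have "foldr (act m) w [] = []" using es(2) l by auto
    then show ?thesis using nonempty Cons l False by (cases l) auto
  qed
qed

end

section \<open>The induced homomorphism\<close>

abbreviation surface_word where
  "surface_word G g p x y t \<equiv>
    ordered_prod G (map (\<lambda>i. comm G (x i) (y i)) [1..<Suc g] @ map t [1..<Suc p])"

abbreviation puncture_classes where
  "puncture_classes G p t \<equiv> {conj_class G (inv\<^bsub>G\<^esub> (t k)) | k. k \<in> {1..(p::nat)}}"

lemma AM_group_carrier:
  "\<phi> \<in> carrier (AM_group G g p x y t) \<longleftrightarrow>
    \<phi> \<in> hom G G \<and> \<phi> \<in> extensional (carrier G) \<and> bij_betw \<phi> (carrier G) (carrier G) \<and>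
    \<phi> (surface_word G g p x y t) = surface_word G g p x y t \<and>
    (\<lambda>c. \<phi> ` c) ` puncture_classes G p t = puncture_classes G p t"
  unfolding AM_group_def Let_def AutoGroup_def auto_def Bij_def by simp

lemma AM_groupD:
  assumes "\<phi> \<in> carrier (AM_group G g p x y t)"
  shows "\<phi> \<in> hom G G" "\<phi> \<in> extensional (carrier G)" "bij_betw \<phi> (carrier G) (carrier G)"
    "\<phi> (surface_word G g p x y t) = surface_word G g p x y t"
    "(\<lambda>c. \<phi> ` c) ` puncture_classes G p t = puncture_classes G p t"
  using assms unfolding AM_group_carrier by - (elim conjE, assumption)+

lemma AM_groupI:
  assumes "\<phi> \<in> hom G G" "\<phi> \<in> extensional (carrier G)" "bij_betw \<phi> (carrier G) (carrier G)"
    "\<phi> (surface_word G g p x y t) = surface_word G g p x y t"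
    "(\<lambda>c. \<phi> ` c) ` puncture_classes G p t = puncture_classes G p t"
  shows "\<phi> \<in> carrier (AM_group G g p x y t)"
  unfolding AM_group_carrier by (intro conjI assms)

lemma AM_group_mult:
  assumes "\<phi> \<in> carrier (AM_group G g p x y t)" "\<chi> \<in> carrier (AM_group G g p x y t)"
  shows "\<phi> \<otimes>\<^bsub>AM_group G g p x y t\<^esub> \<chi> = compose (carrier G) \<chi> \<phi>"
proof -
  have "\<phi> \<in> Bij (carrier G)" "\<chi> \<in> Bij (carrier G)"
    using assms[THEN AM_groupD(2)] assms[THEN AM_groupD(3)] by (auto simp: Bij_def)
  then show ?thesis
    by (simp add: AM_group_def Let_def AutoGroup_def BijGroup_def)
qed

lemma (in group) ordered_prod_closed:
  "set as \<subseteq> carrier G \<Longrightarrow> ordered_prod G as \<in> carrier G"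
  by (induction as) (auto simp: ordered_prod_def)

lemma (in group) conj_class_subset: "a \<in> carrier G \<Longrightarrow> conj_class G a \<subseteq> carrier G"
  by (auto simp: conj_class_def)

section \<open>Automorphisms of a group with marked elements\<close>

locale marked_group = group G for G (structure) +
  fixes g p :: nat and x y t :: "nat \<Rightarrow> 'a"
  assumes x_closed: "\<And>i. i \<in> {1..g} \<Longrightarrow> x i \<in> carrier G"
    and y_closed: "\<And>i. i \<in> {1..g} \<Longrightarrow> y i \<in> carrier G"
    and t_closed: "\<And>k. k \<in> {1..p} \<Longrightarrow> t k \<in> carrier G"
begin

lemma surface_word_closed: "surface_word G g p x y t \<in> carrier G"
  using x_closed y_closed t_closed by (intro ordered_prod_closed) (auto simp: comm_def)

lemma puncture_class_subset: "c \<in> puncture_classes G p t \<Longrightarrow> c \<subseteq> carrier G"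
  using conj_class_subset t_closed by blast

lemma AM_compose_closed:
  assumes \<phi>: "\<phi> \<in> carrier (AM_group G g p x y t)" and \<chi>: "\<chi> \<in> carrier (AM_group G g p x y t)"
  shows "compose (carrier G) \<chi> \<phi> \<in> carrier (AM_group G g p x y t)"
proof -
  let ?C = "puncture_classes G p t" and ?w = "surface_word G g p x y t"
  note \<phi>D = AM_groupD[OF \<phi>] and \<chi>D = AM_groupD[OF \<chi>]
  have "compose (carrier G) \<chi> \<phi> ` c = \<chi> ` \<phi> ` c" if "c \<in> ?C" for c
    using puncture_class_subset[OF that] unfolding image_image
    by (intro image_cong[OF refl]) (auto simp: compose_def)
  then have "(\<lambda>c. compose (carrier G) \<chi> \<phi> ` c) ` ?C = (\<lambda>c. \<chi> ` c) ` (\<lambda>c. \<phi> ` c) ` ?C"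
    unfolding image_image[of "\<lambda>c. \<chi> ` c"] by (rule image_cong[OF refl])
  then have C: "(\<lambda>c. compose (carrier G) \<chi> \<phi> ` c) ` ?C = ?C"
    unfolding \<phi>D(5) \<chi>D(5) .
  have w: "compose (carrier G) \<chi> \<phi> ?w = ?w"
    using \<phi>D(4) \<chi>D(4) surface_word_closed by (simp only: compose_eq)
  show ?thesis
    using AM_groupI[OF hom_compose[OF \<phi>D(1) \<chi>D(1)] compose_extensional bij_betw_compose[OF \<phi>D(3) \<chi>D(3)] w C] .
qed

text \<open>Inverses serve twice: they make the induced maps bijective, and they reduce injectivity
  to automorphisms that induce the identity.\<close>

lemma AM_inverse:
  assumes \<phi>: "\<phi> \<in> carrier (AM_group G g p x y t)"
  obtains \<chi> where "\<chi> \<in> carrier (AM_group G g p x y t)"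
    "\<And>a. a \<in> carrier G \<Longrightarrow> \<chi> (\<phi> a) = a" "\<And>a. a \<in> carrier G \<Longrightarrow> \<phi> (\<chi> a) = a"
proof
  let ?C = "puncture_classes G p t"
  define \<chi> where "\<chi> = restrict (inv_into (carrier G) \<phi>) (carrier G)"
  have bij: "bij_betw \<phi> (carrier G) (carrier G)" and Bij: "\<phi> \<in> Bij (carrier G)"
    and hom: "\<phi> \<in> hom G G" and w: "\<phi> (surface_word G g p x y t) = surface_word G g p x y t"
    and C: "(\<lambda>c. \<phi> ` c) ` ?C = ?C"
    using AM_groupD[OF \<phi>] by (simp_all add: Bij_def)
  have closed: "\<phi> a \<in> carrier G" if "a \<in> carrier G" for a
    using hom that by (rule hom_in_carrier)
  show left: "\<chi> (\<phi> a) = a" if "a \<in> carrier G" for a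
    using that closed bij_betw_inv_into_left[OF bij] by (simp add: \<chi>_def)
  show "\<phi> (\<chi> a) = a" if "a \<in> carrier G" for a
    using that bij_betw_inv_into_right[OF bij] by (simp add: \<chi>_def)
  have "\<chi> ` \<phi> ` c = c" if "c \<in> ?C" for c
    using puncture_class_subset[OF that] left by (force simp: image_image subset_iff)
  then have "(\<lambda>c. \<chi> ` c) ` (\<lambda>c. \<phi> ` c) ` ?C = ?C"
    unfolding image_image[of "\<lambda>c. \<chi> ` c"] by simp
  then have "(\<lambda>c. \<chi> ` c) ` ?C = ?C" unfolding C .
  moreover have "\<chi> (surface_word G g p x y t) = surface_word G g p x y t"
    using left[OF surface_word_closed] unfolding w .
  moreover have "\<chi> \<in> hom G G"
    unfolding \<chi>_def using restrict_inv_into_hom[OF hom Bij] .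
  moreover have "\<chi> \<in> extensional (carrier G)" "bij_betw \<chi> (carrier G) (carrier G)"
    unfolding \<chi>_def using restrict_inv_into_Bij[OF Bij] by (simp_all add: Bij_def)
  ultimately show "\<chi> \<in> carrier (AM_group G g p x y t)"
    by (intro AM_groupI)
qed

end

lemma (in group_hom) hom_comm:
  "a \<in> carrier G \<Longrightarrow> b \<in> carrier G \<Longrightarrow> h (comm G a b) = comm H (h a) (h b)"
  by (simp add: comm_def)

lemma (in group_hom) hom_ordered_prod:
  "set as \<subseteq> carrier G \<Longrightarrow> h (ordered_prod G as) = ordered_prod H (map h as)"
proof (induction as)
  case (Cons a as)
  then show ?case using G.ordered_prod_closed[of as] by (simp add: ordered_prod_def)
qed (simp add: ordered_prod_def)

lemma (in group_hom) hom_surface_word: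
  assumes "marked_group G g p x y t"
  shows "h (surface_word G g p x y t) =
    surface_word H g p (\<lambda>i. h (x i)) (\<lambda>i. h (y i)) (\<lambda>k. h (t k))"
proof -
  interpret marked_group G g p x y t by fact
  have "set (map (\<lambda>i. comm G (x i) (y i)) [1..<Suc g] @ map t [1..<Suc p]) \<subseteq> carrier G"
    using x_closed y_closed t_closed by (auto simp: comm_def)
  then have "h (surface_word G g p x y t) = ordered_prod H (map h
      (map (\<lambda>i. comm G (x i) (y i)) [1..<Suc g] @ map t [1..<Suc p]))"
    by (rule hom_ordered_prod)
  also have "map h (map (\<lambda>i. comm G (x i) (y i)) [1..<Suc g] @ map t [1..<Suc p]) =
      map (\<lambda>i. comm H (h (x i)) (h (y i))) [1..<Suc g] @ map (\<lambda>k. h (t k)) [1..<Suc p]"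
    using x_closed y_closed by (simp del: upt_Suc add: hom_comm)
  finally show ?thesis .
qed

lemma (in group_hom) hom_conj_class:
  assumes "h ` carrier G = carrier H" "a \<in> carrier G"
  shows "h ` conj_class G a = conj_class H (h a)"
proof -
  have "conj_class H (h a) = (\<lambda>k. inv\<^bsub>H\<^esub> k \<otimes>\<^bsub>H\<^esub> h a \<otimes>\<^bsub>H\<^esub> k) ` h ` carrier G"
    unfolding conj_class_def assms(1) by blast
  also have "\<dots> = h ` conj_class G a"
    using assms(2) by (force simp: conj_class_def image_image)
  finally show ?thesis ..
qed

lemma (in group_hom) hom_puncture_classes:
  assumes "marked_group G g p x y t" "h ` carrier G = carrier H"
  shows "puncture_classes H p (\<lambda>k. h (t k)) = (\<lambda>c. h ` c) ` puncture_classes G p t"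
proof -
  interpret marked_group G g p x y t by fact
  have "h ` conj_class G (inv t k) = conj_class H (inv\<^bsub>H\<^esub> (h (t k)))" if "k \<in> {1..p}" for k
    using hom_conj_class[OF assms(2)] t_closed[OF that] by simp
  then show ?thesis by blast
qed

lemma marked_Sigma1: "marked_group (Sigma1 g p) g p (\<lambda>i. gen (X i)) (\<lambda>i. gen (Y i)) (\<lambda>k. gen (T k))"
  by (intro marked_group.intro marked_group_axioms.intro Sigma1_group) (auto simp: Sigma1_def)

lemma natural_hom_group_hom: "group_hom (Sigma1 g p) (Sigma1d g p d) (natural_hom g p d)"
  by (simp add: group_hom_def group_hom_axioms_def Sigma1_group Sigma1d_group natural_hom_hom)

lemma natural_hom_surj: "natural_hom g p d ` carrier (Sigma1 g p) = carrier (Sigma1d g p d)"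
  by (auto simp: Sigma1d_def FactGroup_def RCOSETS_def natural_hom_def)

lemma AM1_inverse:
  assumes "\<phi> \<in> carrier (AM1 g p)"
  obtains \<chi> where "\<chi> \<in> carrier (AM1 g p)"
    "\<And>a. a \<in> carrier (Sigma1 g p) \<Longrightarrow> \<chi> (\<phi> a) = a" "\<And>a. a \<in> carrier (Sigma1 g p) \<Longrightarrow> \<phi> (\<chi> a) = a"
  by (rule marked_group.AM_inverse[OF marked_Sigma1 assms[unfolded AM1_def]])
    (rule that; simp add: AM1_def)

lemma AM1_closed: "\<phi> \<in> carrier (AM1 g p) \<Longrightarrow> a \<in> carrier (Sigma1 g p) \<Longrightarrow> \<phi> a \<in> carrier (Sigma1 g p)"
  by (rule hom_in_carrier[OF AM1_imp_hom])

text \<open>Each property of \<open>\<phi>\<close> descends along the surjection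
  \<open>natural_hom\<close>; bijectivity is witnessed by the map induced by the inverse of
  \<open>\<phi>\<close>.\<close>

lemma psi_in_AM1d:
  assumes \<phi>: "\<phi> \<in> carrier (AM1 g p)"
  shows "psi g p d \<phi> \<in> carrier (AM1d g p d)"
proof -
  let ?G = "Sigma1 g p" and ?H = "Sigma1d g p d" and ?n = "natural_hom g p d" and ?f = "psi g p d \<phi>"
  let ?C = "puncture_classes ?G p (\<lambda>k. gen (T k))"
  interpret n: group_hom ?G ?H ?n by (rule natural_hom_group_hom)
  interpret marked_group ?G g p "\<lambda>i. gen (X i)" "\<lambda>i. gen (Y i)" "\<lambda>k. gen (T k)"
    by (rule marked_Sigma1)
  have \<phi>_hom: "\<phi> \<in> hom ?G ?G" and \<phi>_w: "\<phi> (surface_word ?G g p (\<lambda>i. gen (X i)) (\<lambda>i. gen (Y i)) (\<lambda>k. gen (T k)))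
      = surface_word ?G g p (\<lambda>i. gen (X i)) (\<lambda>i. gen (Y i)) (\<lambda>k. gen (T k))"
    and \<phi>_C: "(\<lambda>c. \<phi> ` c) ` ?C = ?C"
    by (rule AM_groupD[OF \<phi>[unfolded AM1_def]])+
  note f = psi_natural_hom[OF \<phi>, of _ d]
  have surj: "\<exists>a\<in>carrier ?G. b = ?n a" if "b \<in> carrier ?H" for b
    using that natural_hom_surj[of g p d] by blast
  have closed: "?f b \<in> carrier ?H" if b: "b \<in> carrier ?H" for b
  proof -
    obtain a where a: "a \<in> carrier ?G" "b = ?n a" using surj[OF b] by blast
    show ?thesis unfolding a(2) f[OF a(1)] using AM1_closed[OF \<phi> a(1)] by (rule n.hom_closed)
  qed
  obtain \<chi> where \<chi>: "\<chi> \<in> carrier (AM1 g p)"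
    "\<And>a. a \<in> carrier ?G \<Longrightarrow> \<chi> (\<phi> a) = a" "\<And>a. a \<in> carrier ?G \<Longrightarrow> \<phi> (\<chi> a) = a"
    using AM1_inverse[OF \<phi>] by blast
  have "?f \<in> hom ?H ?H"
  proof (rule homI[OF closed])
    fix b c assume "b \<in> carrier ?H" "c \<in> carrier ?H"
    then obtain a a' where a: "a \<in> carrier ?G" "b = ?n a" "a' \<in> carrier ?G" "c = ?n a'"
      using surj by blast
    then have "?f (b \<otimes>\<^bsub>?H\<^esub> c) = ?n (\<phi> (a \<otimes>\<^bsub>?G\<^esub> a'))"
      using f[of "a \<otimes>\<^bsub>?G\<^esub> a'"] by simp
    then show "?f (b \<otimes>\<^bsub>?H\<^esub> c) = ?f b \<otimes>\<^bsub>?H\<^esub> ?f c"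
      using a AM1_closed[OF \<phi>] by (simp add: f hom_mult[OF \<phi>_hom])
  qed
  moreover have "bij_betw ?f (carrier ?H) (carrier ?H)"
  proof (rule bij_betw_byWitness[where f' = "psi g p d \<chi>"])
    have \<chi>_psi: "psi g p d \<chi> (?n a) = ?n (\<chi> a)" if "a \<in> carrier ?G" for a
      using psi_natural_hom[OF \<chi>(1) that] .
    show "\<forall>b\<in>carrier ?H. psi g p d \<chi> (?f b) = b"
      unfolding natural_hom_surj[of g p d, symmetric] using AM1_closed[OF \<phi>] \<chi>(2)
      by (simp add: f \<chi>_psi)
    show "\<forall>b\<in>carrier ?H. ?f (psi g p d \<chi> b) = b"
      unfolding natural_hom_surj[of g p d, symmetric] using AM1_closed[OF \<chi>(1)] \<chi>(3)
      by (simp add: f \<chi>_psi)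
    show "?f ` carrier ?H \<subseteq> carrier ?H"
      using closed by blast
    show "psi g p d \<chi> ` carrier ?H \<subseteq> carrier ?H"
      unfolding natural_hom_surj[of g p d, symmetric] using AM1_closed[OF \<chi>(1)]
      by (auto simp: \<chi>_psi)
  qed
  moreover have "?f \<in> extensional (carrier ?H)"
    by (simp add: psi_def)
  moreover have "?f (surface_word ?H g p (\<lambda>i. ?n (gen (X i))) (\<lambda>i. ?n (gen (Y i))) (\<lambda>k. ?n (gen (T k))))
      = surface_word ?H g p (\<lambda>i. ?n (gen (X i))) (\<lambda>i. ?n (gen (Y i))) (\<lambda>k. ?n (gen (T k)))"
    using f[OF surface_word_closed] unfolding \<phi>_w n.hom_surface_word[OF marked_Sigma1] .
  moreover have "(\<lambda>c. ?f ` c) ` puncture_classes ?H p (\<lambda>k. ?n (gen (T k)))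
      = puncture_classes ?H p (\<lambda>k. ?n (gen (T k)))"
  proof -
    have "?f ` ?n ` c = ?n ` \<phi> ` c" if "c \<in> ?C" for c
      using puncture_class_subset[OF that] unfolding image_image
      by (intro image_cong[OF refl]) (auto simp: f)
    then have "(\<lambda>c. ?f ` c) ` (\<lambda>c. ?n ` c) ` ?C = (\<lambda>c. ?n ` c) ` (\<lambda>c. \<phi> ` c) ` ?C"
      unfolding image_image[of _ "image _" ?C] by (rule image_cong[OF refl])
    then show ?thesis
      unfolding \<phi>_C n.hom_puncture_classes[OF marked_Sigma1 natural_hom_surj] .
  qed
  ultimately show ?thesis
    unfolding AM1d_def by (intro AM_groupI)
qed

theorem psi_hom: "psi g p d \<in> hom (AM1 g p) (AM1d g p d)"
proof (rule homI[OF psi_in_AM1d])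
  fix \<phi> \<chi> assume \<phi>: "\<phi> \<in> carrier (AM1 g p)" and \<chi>: "\<chi> \<in> carrier (AM1 g p)"
  let ?G = "Sigma1 g p" and ?H = "Sigma1d g p d" and ?n = "natural_hom g p d"
  have comp: "compose (carrier ?G) \<chi> \<phi> \<in> carrier (AM1 g p)"
    using marked_group.AM_compose_closed[OF marked_Sigma1] \<phi> \<chi> unfolding AM1_def by blast
  have "psi g p d (compose (carrier ?G) \<chi> \<phi>) = compose (carrier ?H) (psi g p d \<chi>) (psi g p d \<phi>)"
  proof (rule extensionalityI[of _ "carrier ?H"])
    fix b assume b: "b \<in> carrier ?H"
    then obtain a where a: "a \<in> carrier ?G" "b = ?n a"
      using natural_hom_surj[of g p d] by blast
    then show "psi g p d (compose (carrier ?G) \<chi> \<phi>) b = compose (carrier ?H) (psi g p d \<chi>) (psi g p d \<phi>) b"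
      using b psi_natural_hom[OF comp] psi_natural_hom[OF \<phi>] psi_natural_hom[OF \<chi>] AM1_closed[OF \<phi>]
      by (simp add: compose_eq)
  qed (simp_all add: psi_def)
  then show "psi g p d (\<phi> \<otimes>\<^bsub>AM1 g p\<^esub> \<chi>) = psi g p d \<phi> \<otimes>\<^bsub>AM1d g p d\<^esub> psi g p d \<chi>"
    using AM_group_mult[OF \<phi>[unfolded AM1_def] \<chi>[unfolded AM1_def]]
      AM_group_mult[OF psi_in_AM1d[OF \<phi>, unfolded AM1d_def] psi_in_AM1d[OF \<chi>, unfolded AM1d_def]]
    by (simp add: AM1_def AM1d_def)
qed

text \<open>If \<open>\<phi>\<close> and \<open>\<chi>\<close> induce the same map, then
  \<open>\<phi>\<close> followed by the inverse of \<open>\<chi>\<close> induces the identity, so a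
  trivial kernel suffices.\<close>

lemma psi_inj_onI:
  assumes triv: "\<And>\<theta> a. \<theta> \<in> carrier (AM1 g p) \<Longrightarrow>
      (\<And>a. a \<in> carrier (Sigma1 g p) \<Longrightarrow> natural_hom g p d (\<theta> a) = natural_hom g p d a) \<Longrightarrow>
      a \<in> carrier (Sigma1 g p) \<Longrightarrow> \<theta> a = a"
  shows "inj_on (psi g p d) (carrier (AM1 g p))"
proof (rule inj_onI)
  fix \<phi> \<chi> assume \<phi>: "\<phi> \<in> carrier (AM1 g p)" and \<chi>: "\<chi> \<in> carrier (AM1 g p)"
    and eq: "psi g p d \<phi> = psi g p d \<chi>"
  let ?G = "Sigma1 g p" and ?n = "natural_hom g p d"
  obtain \<chi>' where \<chi>': "\<chi>' \<in> carrier (AM1 g p)"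
    "\<And>a. a \<in> carrier ?G \<Longrightarrow> \<chi>' (\<chi> a) = a" "\<And>a. a \<in> carrier ?G \<Longrightarrow> \<chi> (\<chi>' a) = a"
    using AM1_inverse[OF \<chi>] by blast
  let ?\<theta> = "compose (carrier ?G) \<chi>' \<phi>"
  have \<theta>: "?\<theta> \<in> carrier (AM1 g p)"
    using marked_group.AM_compose_closed[OF marked_Sigma1] \<phi> \<chi>'(1) unfolding AM1_def by blast
  have "?n (?\<theta> a) = ?n a" if a: "a \<in> carrier ?G" for a
  proof -
    have "?n (\<phi> a) = ?n (\<chi> a)"
      using psi_natural_hom[OF \<phi> a, of d] psi_natural_hom[OF \<chi> a, of d] eq by simp
    then have "?n (\<chi>' (\<phi> a)) = ?n (\<chi>' (\<chi> a))"
      using psi_natural_hom[OF \<chi>'(1)] AM1_closed[OF \<phi> a] AM1_closed[OF \<chi> a] by metis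
    then show ?thesis using a \<chi>'(2) by (simp add: compose_eq)
  qed
  then have \<theta>_id: "?\<theta> a = a" if "a \<in> carrier ?G" for a
    using triv[OF \<theta>] that by blast
  show "\<phi> = \<chi>"
  proof (rule extensionalityI[of _ "carrier ?G"])
    show "\<phi> \<in> extensional (carrier ?G)" "\<chi> \<in> extensional (carrier ?G)"
      by (rule AM_groupD(2)[OF \<phi>[unfolded AM1_def]] AM_groupD(2)[OF \<chi>[unfolded AM1_def]])+
    fix a assume a: "a \<in> carrier ?G"
    then have "\<chi> (\<chi>' (\<phi> a)) = \<chi> a" using \<theta>_id[OF a] by (simp add: compose_eq)
    then show "\<phi> a = \<chi> a" using \<chi>'(3) AM1_closed[OF \<phi> a] by simp
  qed
qed

section \<open>Injectivity\<close>

definition surface_letters :: "nat \<Rightarrow> nat \<Rightarrow> surface_gen letter list list" where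
  "surface_letters g p =
    map (\<lambda>i. [(X i, False), (Y i, False), (X i, True), (Y i, True)]) [1..<Suc g] @
    map (\<lambda>k. [(T k, True)]) [1..<Suc p]"

text \<open>Read off from the surface word: after the leg come, for each handle,
  \<open>x\<close>-inverse, \<open>y\<close>, \<open>x\<close>, \<open>y\<close>-inverse, and then,
  for each puncture, \<open>t\<close>, \<open>t\<close>-inverse. The offset of the punctures puts
  \<open>T 1\<close> right after \<open>Y g\<close> inverse, which has position
  \<open>4 * g + 3\<close>.\<close>

fun surface_pos :: "nat \<Rightarrow> surface_gen letter \<Rightarrow> nat" where
  "surface_pos g (X i, b) = 4 * i + (if b then 2 else 0)"
| "surface_pos g (Y i, b) = 4 * i + (if b then 1 else 3)"
| "surface_pos g (T k, b) = 4 * g + 2 * k + (if b then 2 else 3)"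

abbreviation surface_gens :: "nat \<Rightarrow> nat \<Rightarrow> surface_gen set" where
  "surface_gens g p \<equiv> X ` {1..g} \<union> Y ` {1..g} \<union> T ` {1..p}"

lemma surface_letters_Suc:
  "concat (surface_letters (Suc g) 0) = concat (surface_letters g 0) @
    [(X (Suc g), False), (Y (Suc g), False), (X (Suc g), True), (Y (Suc g), True)]"
  "concat (surface_letters g (Suc p)) = concat (surface_letters g p) @ [(T (Suc p), True)]"
  by (simp_all add: surface_letters_def)

lemma surface_letters_0 [simp]: "surface_letters 0 0 = []"
  by (simp add: surface_letters_def)

lemma last_surface_word:
  "last (concat (surface_letters g p)) = (if p = 0 then (Y g, True) else (T p, True))"
  if "g \<noteq> 0 \<or> p \<noteq> 0"
  using that by (cases p; cases g) (simp_all add: surface_letters_Suc)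

lemma hd_surface_word:
  "hd (concat (surface_letters g p)) = (if g = 0 then (T 1, True) else (X 1, False))"
  if "g \<noteq> 0 \<or> p \<noteq> 0"
proof (cases "g = 0")
  case True
  then show ?thesis using that by (simp add: surface_letters_def upt_conv_Cons del: upt_Suc)
next
  case False
  then show ?thesis by (simp add: surface_letters_def upt_conv_Cons del: upt_Suc)
qed

text \<open>The parameter \<open>h\<close> of the positions is kept apart from \<open>g\<close> so
  that it stays fixed in the induction on handles; the positions of \<open>X i\<close> and
  \<open>Y i\<close> do not depend on it.\<close>

lemma surface_word_succ:
  "successively (\<lambda>l m. surface_pos h m = Suc (surface_pos h (flip l))) (concat (surface_letters g p))"
  if "p = 0 \<or> g = h"
  using that
proof (induction p)
  case 0
  show ?case
  proof (induction g)
    case (Suc g)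
    then show ?case
      using last_surface_word[of g 0]
      by (cases "g = 0") (simp_all add: surface_letters_Suc successively_append_iff flip_Pair)
  qed simp
next
  case (Suc p)
  then show ?case
    using last_surface_word[of g p]
    by (cases "p = 0"; cases "g = 0")
      (simp_all add: surface_letters_Suc successively_append_iff flip_Pair)
qed

lemma surface_ribbon:
  "ribbon (surface_gens g p) (T ` {1..p}) (surface_pos g) (concat (surface_letters g p))"
proof
  show "inj_on (surface_pos g) {l. fst l \<in> surface_gens g p}"
  proof (rule inj_onI)
    fix l m assume "l \<in> {l. fst l \<in> surface_gens g p}" "m \<in> {l. fst l \<in> surface_gens g p}"
      "surface_pos g l = surface_pos g m"
    then show "l = m"
      by (cases l; cases m) (auto split: if_splits; presburger)
  qed
  show "fst ` set (concat (surface_letters g p)) \<subseteq> surface_gens g p"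
    by (auto simp: surface_letters_def)
  show "l \<in> set (concat (surface_letters g p))"
    if "fst l \<in> surface_gens g p" "snd l \<or> fst l \<notin> T ` {1..p}" for l
    using that by (cases l) (auto simp: surface_letters_def simp del: upt_Suc)
  show "successively (\<lambda>l m. surface_pos g m = Suc (surface_pos g (flip l))) (concat (surface_letters g p))"
    by (rule surface_word_succ) simp
  have ne: "g \<noteq> 0 \<or> p \<noteq> 0" if "concat (surface_letters g p) \<noteq> []"
    using that by (cases "g = 0 \<and> p = 0") auto
  show "surface_pos g (hd (concat (surface_letters g p))) \<le> surface_pos g l"
    if "concat (surface_letters g p) \<noteq> []" "fst l \<in> surface_gens g p" for l
    using that(2) hd_surface_word[OF ne[OF that(1)]] by (cases l) auto
  show "surface_pos g l \<le> surface_pos g (flip (last (concat (surface_letters g p))))"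
    if "concat (surface_letters g p) \<noteq> []" "fst l \<in> surface_gens g p" for l
    using that(2) last_surface_word[OF ne[OF that(1)]] by (cases l) (auto simp: flip_def)
qed (auto simp: flip_def)

lemma ordered_prod_concat:
  "reduced (concat ws) \<Longrightarrow> ordered_prod (free_group S) ws = concat ws"
proof (induction ws)
  case (Cons w ws)
  then have "reduced (concat ws)" by (simp add: reduced_append)
  then show ?case
    using Cons foldr_push_append[of w "concat ws"]
    by (simp add: ordered_prod_def free_group_mult del: foldr_append)
qed (simp add: ordered_prod_def free_group_one)

lemma surface_word_Sigma1:
  "surface_word (Sigma1 g p) g p (\<lambda>i. gen (X i)) (\<lambda>i. gen (Y i)) (\<lambda>k. gen (T k)) =
    concat (surface_letters g p)"
proof -
  interpret ribbon "surface_gens g p" "T ` {1..p}" "surface_pos g" "concat (surface_letters g p)"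
    by (rule surface_ribbon)
  have "comm (Sigma1 g p) (gen (X i)) (gen (Y i)) =
      [(X i, False), (Y i, False), (X i, True), (Y i, True)]" if "i \<in> {1..g}" for i
  proof -
    have "gen (X i) \<in> carrier (Sigma1 g p)" "gen (Y i) \<in> carrier (Sigma1 g p)"
      using that by (auto simp: Sigma1_def)
    then show ?thesis
      by (simp add: comm_def Sigma1_def free_group_inv free_group_mult flip_def)
  qed
  then have "map (\<lambda>i. comm (Sigma1 g p) (gen (X i)) (gen (Y i))) [1..<Suc g]
      @ map (\<lambda>k. gen (T k)) [1..<Suc p] = surface_letters g p"
    by (simp add: surface_letters_def del: upt_Suc)
  \<comment> \<open>The ribbon structure already shows that the concatenation is reduced, so
    multiplying the blocks cancels nothing.\<close>
  then show ?thesis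
    using ordered_prod_concat[OF reduced_W] by (simp add: Sigma1_def)
qed

text \<open>The homomorphism to the integers with value \<open>1\<close> on every generator. Being
  constant on conjugacy classes, it distinguishes a conjugate of some \<open>t_j\<close> from the
  inverse of \<open>t_k\<close>.\<close>

definition exp_sum :: "'a letter list \<Rightarrow> int" where
  "exp_sum w = (\<Sum>l\<leftarrow>w. if snd l then 1 else -1)"

lemma exp_sum_push: "exp_sum (push l w) = (if snd l then 1 else -1) + exp_sum w"
  by (cases w) (auto simp: exp_sum_def flip_def)

lemma exp_sum_mult: "exp_sum (u \<otimes>\<^bsub>free_group S\<^esub> v) = exp_sum u + exp_sum v"
  unfolding free_group_mult by (induction u) (simp_all add: exp_sum_push, simp_all add: exp_sum_def)

lemma exp_sum_conj:
  assumes "c \<in> carrier (free_group S)"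
  shows "exp_sum (inv\<^bsub>free_group S\<^esub> c \<otimes>\<^bsub>free_group S\<^esub> w \<otimes>\<^bsub>free_group S\<^esub> c) = exp_sum w"
proof -
  interpret group "free_group S" by (rule free_group_group)
  have "exp_sum (inv\<^bsub>free_group S\<^esub> c) + exp_sum c = exp_sum (\<one>\<^bsub>free_group S\<^esub>)"
    using assms exp_sum_mult[of S "inv\<^bsub>free_group S\<^esub> c" c] by simp
  moreover have "exp_sum (\<one>\<^bsub>free_group S\<^esub>) = 0"
    by (simp add: free_group_one exp_sum_def)
  ultimately show ?thesis by (simp add: exp_sum_mult)
qed

lemma AM1_conj:
  assumes \<theta>: "\<theta> \<in> carrier (AM1 g p)" and k: "k \<in> {1..p}"
  obtains j c where "j \<in> {1..p}" "c \<in> carrier (Sigma1 g p)"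
    "\<theta> (gen (T k)) = inv\<^bsub>Sigma1 g p\<^esub> c \<otimes>\<^bsub>Sigma1 g p\<^esub> gen (T j) \<otimes>\<^bsub>Sigma1 g p\<^esub> c"
proof -
  let ?G = "Sigma1 g p" and ?C = "puncture_classes (Sigma1 g p) p (\<lambda>k. gen (T k))"
  interpret group ?G by (rule Sigma1_group)
  interpret \<theta>: group_hom ?G ?G \<theta>
    using AM1_imp_hom[OF \<theta>] by (simp add: group_hom_def group_hom_axioms_def Sigma1_group)
  have C: "(\<lambda>c. \<theta> ` c) ` ?C = ?C"
    by (rule AM_groupD(5)[OF \<theta>[unfolded AM1_def]])
  have tk: "gen (T k) \<in> carrier ?G" using gen_T_closed[OF k] .
  have "inv\<^bsub>?G\<^esub> gen (T k) = inv\<^bsub>?G\<^esub> \<one>\<^bsub>?G\<^esub> \<otimes>\<^bsub>?G\<^esub> inv\<^bsub>?G\<^esub> gen (T k) \<otimes>\<^bsub>?G\<^esub> \<one>\<^bsub>?G\<^esub>"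
    using tk by simp
  then have "inv\<^bsub>?G\<^esub> gen (T k) \<in> conj_class ?G (inv\<^bsub>?G\<^esub> gen (T k))"
    unfolding conj_class_def by blast
  moreover have "\<theta> ` conj_class ?G (inv\<^bsub>?G\<^esub> gen (T k)) \<in> ?C"
    using C k by blast
  ultimately obtain j where j: "j \<in> {1..p}" "\<theta> (inv\<^bsub>?G\<^esub> gen (T k)) \<in> conj_class ?G (inv\<^bsub>?G\<^esub> gen (T j))"
    by blast
  then obtain c where c: "c \<in> carrier ?G"
    "\<theta> (inv\<^bsub>?G\<^esub> gen (T k)) = inv\<^bsub>?G\<^esub> c \<otimes>\<^bsub>?G\<^esub> inv\<^bsub>?G\<^esub> gen (T j) \<otimes>\<^bsub>?G\<^esub> c"
    unfolding conj_class_def by blast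
  have tj: "gen (T j) \<in> carrier ?G" using gen_T_closed[OF j(1)] .
  have "\<theta> (gen (T k)) = inv\<^bsub>?G\<^esub> (\<theta> (inv\<^bsub>?G\<^esub> gen (T k)))"
    using tk by simp
  also have "\<dots> = inv\<^bsub>?G\<^esub> c \<otimes>\<^bsub>?G\<^esub> gen (T j) \<otimes>\<^bsub>?G\<^esub> c"
    unfolding c(2) using c(1) tj by (simp add: inv_mult_group m_assoc)
  finally show ?thesis using that j(1) c(1) by blast
qed

lemma AM1_ribbon_auto:
  assumes \<theta>: "\<theta> \<in> carrier (AM1 g p)"
  shows "ribbon_auto (surface_gens g p) (T ` {1..p}) (surface_pos g) (concat (surface_letters g p)) \<theta>"
proof (intro ribbon_auto.intro ribbon_auto_axioms.intro surface_ribbon)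
  show "\<theta> \<in> hom (free_group (surface_gens g p)) (free_group (surface_gens g p))"
    using AM1_imp_hom[OF \<theta>] by (simp add: Sigma1_def)
  show "bij_betw \<theta> (carrier (free_group (surface_gens g p))) (carrier (free_group (surface_gens g p)))"
    using AM_groupD(3)[OF \<theta>[unfolded AM1_def]] unfolding Sigma1_def .
  show "\<theta> (concat (surface_letters g p)) = concat (surface_letters g p)"
    using AM_groupD(4)[OF \<theta>[unfolded AM1_def]] unfolding surface_word_Sigma1 .
  show "\<exists>j\<in>T ` {1..p}. \<exists>c\<in>carrier (free_group (surface_gens g p)). \<theta> (gen t) =
      inv\<^bsub>free_group (surface_gens g p)\<^esub> c \<otimes>\<^bsub>free_group (surface_gens g p)\<^esub> gen j
      \<otimes>\<^bsub>free_group (surface_gens g p)\<^esub> c" if t: "t \<in> T ` {1..p}" for t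
  proof -
    obtain k where k: "k \<in> {1..p}" "t = T k" using t by blast
    obtain j c where j: "j \<in> {1..p}" and c: "c \<in> carrier (Sigma1 g p)" and
      eq: "\<theta> (gen (T k)) = inv\<^bsub>Sigma1 g p\<^esub> c \<otimes>\<^bsub>Sigma1 g p\<^esub> gen (T j) \<otimes>\<^bsub>Sigma1 g p\<^esub> c"
      using AM1_conj[OF \<theta> k(1)] .
    show ?thesis
      using c eq unfolding k(2) Sigma1_def by (intro bexI[OF _ imageI[OF j]]) (rule bexI)
  qed
qed

section \<open>Automorphisms inducing the identity on the quotient\<close>

fun torsion :: "nat \<Rightarrow> surface_gen \<Rightarrow> nat" where
  "torsion d (T k) = d"
| "torsion d _ = 0"

text \<open>Representatives of one coset differ by a kernel element, which acts trivially, so the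
  normal form depends on the coset only.\<close>

lemma natural_hom_act:
  assumes d: "d \<ge> 2" and a: "a \<in> carrier (Sigma1 g p)" and b: "b \<in> carrier (Sigma1 g p)"
    and eq: "natural_hom g p d a = natural_hom g p d b"
  shows "foldr (act (torsion d)) a [] = foldr (act (torsion d)) b []"
proof -
  interpret N: normal "Sigma1d_kernel g p d" "Sigma1 g p" by (rule Sigma1d_kernel_normal)
  have tor: "torsion d s \<noteq> 1" for s using d by (cases s) auto
  have "a \<in> natural_hom g p d b"
    using N.rcos_self[OF a N.subgroup_axioms] unfolding natural_hom_def[symmetric] eq .
  then obtain n where n: "n \<in> Sigma1d_kernel g p d" "a = n \<otimes>\<^bsub>Sigma1 g p\<^esub> b"
    by (auto simp: natural_hom_def r_coset_def)
  have rel: "r \<in> carrier (free_group (surface_gens g p)) \<and>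
      (\<exists>s. r = replicate (torsion d s) (s, True) \<and> torsion d s \<noteq> 0)" if r: "r \<in> power_relators g p d" for r
  proof -
    obtain k where k: "k \<in> {1..p}" "r = gen (T k) [^]\<^bsub>Sigma1 g p\<^esub> d"
      using r by (auto simp: power_relators_def)
    have "r \<in> carrier (Sigma1 g p)"
      unfolding k(2) using gen_T_closed[OF k(1)] by (rule N.nat_pow_closed)
    moreover have "r = replicate (torsion d (T k)) (T k, True)"
      using k(2) by (simp add: Sigma1_def letter_pow)
    ultimately show ?thesis using d by (intro conjI exI[of _ "T k"]) (simp_all add: Sigma1_def)
  qed
  have "foldr (act (torsion d)) a [] = foldr (act (torsion d)) n (foldr (act (torsion d)) b [])"
    using foldr_act_mult[of "torsion d" "[]" n b, OF tor] by (simp add: n(2) Sigma1_def free_group_mult)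
  also have "\<dots> = foldr (act (torsion d)) b []"
    using foldr_act_normal_closure[of "torsion d" "power_relators g p d" "surface_gens g p" n, OF tor rel]
      n(1) syllables_foldr[of "torsion d" "[]" b, OF tor]
    by (simp add: Sigma1d_kernel_def Sigma1_def)
  finally show ?thesis .
qed

lemma AM1_fixes_gen:
  assumes d: "d \<ge> 2" and \<theta>: "\<theta> \<in> carrier (AM1 g p)" and s: "s \<in> surface_gens g p"
    and eq: "natural_hom g p d (\<theta> (gen s)) = natural_hom g p d (gen s)"
  shows "\<theta> (gen s) = gen s"
proof -
  interpret ribbon_auto "surface_gens g p" "T ` {1..p}" "surface_pos g" "concat (surface_letters g p)" \<theta>
    by (rule AM1_ribbon_auto[OF \<theta>])
  have u: "gen s \<in> carrier (Sigma1 g p)" using s by (simp add: Sigma1_def)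
  then have v: "\<theta> (gen s) \<in> carrier (Sigma1 g p)" by (rule AM1_closed[OF \<theta>])
  have tor: "torsion d s \<noteq> 1" for s using d by (cases s) auto
  have letters: "fst ` set (\<theta> (gen s)) \<subseteq> surface_gens g p" and red: "reduced (\<theta> (gen s))"
    using v by (simp_all add: Sigma1_def free_group_carrier)
  have "successively (\<lambda>l k. l = k \<longrightarrow> torsion d (fst l) = 0) (\<theta> (gen s))"
    using \<phi>_gen_squarefree[OF s]
  proof (rule successively_mono)
    fix l k assume "l \<in> set (\<theta> (gen s))" "l = k \<longrightarrow> fst l \<notin> T ` {1..p}"
    then show "l = k \<longrightarrow> torsion d (fst l) = 0"
      using letters by auto
  qed
  then have "\<theta> (gen s) = gen s \<or> torsion d s \<noteq> 0 \<and> \<theta> (gen s) = [(s, False)]"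
    using squarefree_eq_gen[of "torsion d", OF tor red] natural_hom_act[OF d v u eq] by blast
  moreover have False if tor_s: "torsion d s \<noteq> 0" and neg: "\<theta> (gen s) = [(s, False)]"
  proof -
    obtain k where k: "k \<in> {1..p}" "s = T k" using tor_s s by auto
    obtain j c where "c \<in> carrier (Sigma1 g p)"
        "\<theta> (gen (T k)) = inv\<^bsub>Sigma1 g p\<^esub> c \<otimes>\<^bsub>Sigma1 g p\<^esub> gen (T j) \<otimes>\<^bsub>Sigma1 g p\<^esub> c"
      using AM1_conj[OF \<theta> k(1)] by blast
    \<comment> \<open>The exponent sum is \<open>1\<close> for a conjugate of
      \<open>gen (T j)\<close> but \<open>-1\<close> for the inverse letter.\<close>
    then have "exp_sum (\<theta> (gen s)) = exp_sum (gen (T j))"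
      unfolding k(2) Sigma1_def by (simp only: exp_sum_conj)
    then show False unfolding neg by (simp add: exp_sum_def)
  qed
  ultimately show ?thesis by blast
qed

lemma free_group_hom_eqI:
  assumes \<theta>: "\<theta> \<in> hom (free_group S) (free_group S)"
    and gens: "\<And>s. s \<in> S \<Longrightarrow> \<theta> (gen s) = gen s"
    and a: "a \<in> carrier (free_group S)"
  shows "\<theta> a = a"
proof -
  interpret \<theta>: group_hom "free_group S" "free_group S" \<theta>
    using \<theta> by (simp add: group_hom_def group_hom_axioms_def free_group_group)
  have letter: "\<theta> [l] = [l]" if l: "fst l \<in> S" for l
  proof (cases "snd l")
    case True
    then show ?thesis using gens[OF l] by (metis prod.collapse)
  next
    case False
    then have "[l] = inv\<^bsub>free_group S\<^esub> (gen (fst l))"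
      using l by (simp add: free_group_inv flip_def prod_eq_iff)
    then show ?thesis using l gens[OF l] by simp
  qed
  show ?thesis
    using a
  proof (induction a)
    case Nil
    then show ?case using \<theta>.hom_one by (simp add: free_group_one)
  next
    case (Cons l a)
    then have closed: "a \<in> carrier (free_group S)" "[l] \<in> carrier (free_group S)" "fst l \<in> S"
      by (auto simp: free_group_carrier reduced_Cons)
    have "l # a = [l] \<otimes>\<^bsub>free_group S\<^esub> a"
      using Cons.prems foldr_push_append[of "[l]" a] by (simp add: free_group_carrier free_group_mult)
    then show ?case using closed Cons.IH letter by simp
  qed
qed

theorem theorem2p1:
  fixes g p d :: nat
  assumes "d \<ge> 2"
  shows "psi g p d \<in> hom (AM1 g p) (AM1d g p d) \<and> inj_on (psi g p d) (carrier (AM1 g p))"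
proof
  show "psi g p d \<in> hom (AM1 g p) (AM1d g p d)" by (rule psi_hom)
  show "inj_on (psi g p d) (carrier (AM1 g p))"
  proof (rule psi_inj_onI)
    fix \<theta> a
    assume \<theta>: "\<theta> \<in> carrier (AM1 g p)" and a: "a \<in> carrier (Sigma1 g p)"
      and eq: "\<And>a. a \<in> carrier (Sigma1 g p) \<Longrightarrow> natural_hom g p d (\<theta> a) = natural_hom g p d a"
    have "\<theta> (gen s) = gen s" if "s \<in> surface_gens g p" for s
      using AM1_fixes_gen[OF assms \<theta> that] eq that by (simp add: Sigma1_def)
    then show "\<theta> a = a"
      using free_group_hom_eqI[of \<theta>] AM1_imp_hom[OF \<theta>] a unfolding Sigma1_def by blast
  qed
qed

end
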